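(* Let $\mathbb{K}$ be a field and let $R$ be a reduced standard graded $\mathbb{K}$-algebra. Then for all integers $t\ge 1$ and $\ell\ge 1$, $$\delta_R(t,\ell)\ \ge\ \delta_R(t+1,\ell),$$ where $\delta_R$ is the generalized minimum distance function of $R$. Consequently, for each $\ell\geq 1$, the value $\delta_R(t,\ell)$ is constant for all $t\gg 0$.
   Context: A standard graded $\mathbb{K}$-algebra is a (commutative, Noetherian) graded ring $R=\bigoplus_{t\ge 0}R_t$ with $R_0=\mathbb{K}$, generated as a $\mathbb{K}$-algebra by finitely many elements of $R_1$. Put $d=\dim(R)$. For a finitely generated graded $R$-module $M$, let $h_M(i)=\dim_{\mathbb{K}}[M]_i$ and let $$\mathrm{e}(M)=\lim_{t\to\infty}\frac{d!\,\sum_{i\le t}h_M(i)}{t^{d}}$$ be its Hilbert-Samuel multiplicity as an $R$-module (so $\mathrm{e}(M)=0$ if $\dim(M)<d$). For positive integers $t,\ell$, let $\mathcal{F}_{t,\ell}$ be the collection of sets $F=\{f_1,\ldots,f_\ell\}\subseteq R_t$ such that $f_1,\ldots,f_\ell$ are $\mathbb{K}$-linearly independent and $\mathrm{Ann}_R(F)=\{r\in R\mid rf_i=0\text{ for all }i\}\neq 0$. The generalized minimum distance function of $R$ is $$\delta_R(t,\ell)=\begin{cases}\mathrm{e}(R)-\max\{\mathrm{e}(R/(F))\mid F\in\mathcal{F}_{t,\ell}\}&\text{if }\mathcal{F}_{t,\ell}\neq\varnothing,\\ \mathrm{e}(R)&\text{if }\mathcal{F}_{t,\ell}=\varnothing.\end{cases}$$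 *)

theory Defs
  imports
    Complex_Main
    "HOL-Library.Extended_Nat"
    "HOL-Algebra.Generated_Rings"
    "HOL-Algebra.Ring_Divisibility"
    "Jordan_Normal_Form.Missing_VectorSpace"
begin

text \<open>The field \<open>K\<close> is a subset of the carrier, so that \<open>R\<^sub>0 = K\<close> is a literal equation; the
  family \<open>G\<close> is the grading.\<close>

locale standard_graded_algebra = cring R + noetherian_ring R
  for R :: "('a, 'b) ring_scheme" (structure) +
  fixes K :: "'a set" and G :: "nat \<Rightarrow> 'a set"
  assumes subfield_K: "subfield K R"
    and additive_subgroup_G: "additive_subgroup (G i) R"
    and mult_G: "\<lbrakk> a \<in> G i; b \<in> G j \<rbrakk> \<Longrightarrow> a \<otimes> b \<in> G (i + j)"
    and decomposition: "x \<in> carrier R \<Longrightarrow>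
      \<exists>!f. (\<forall>i. f i \<in> G i) \<and> finite {i. f i \<noteq> \<zero>} \<and> x = (\<Oplus>i\<in>{i. f i \<noteq> \<zero>}. f i)"
    and G_0: "G 0 = K"
    and generated: "\<exists>S. finite S \<and> S \<subseteq> G 1 \<and> generate_ring R (K \<union> S) = carrier R"

definition reduced_ring :: "('a, 'b) ring_scheme \<Rightarrow> bool" where
  "reduced_ring R \<longleftrightarrow>
    cring R \<and> (\<forall>x\<in>carrier R. \<forall>n::nat. x [^]\<^bsub>R\<^esub> n = \<zero>\<^bsub>R\<^esub> \<longrightarrow> x = \<zero>\<^bsub>R\<^esub>)"

definition krull_dim :: "('a, 'b) ring_scheme \<Rightarrow> enat" where
  "krull_dim R = Sup {enat n |n.
    \<exists>P. (\<forall>i\<le>n. primeideal (P i) R) \<and> (\<forall>i<n. P i \<subset> P (Suc i))}"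

text \<open>A ring \<open>S\<close> as a module over \<open>R\<close> along a ring homomorphism \<open>h\<close> from \<open>R\<close> to \<open>S\<close>.\<close>

definition module_via :: "('r \<Rightarrow> 's) \<Rightarrow> ('s, 'b) ring_scheme \<Rightarrow> ('r, 's) module" where
  "module_via h S = \<lparr>carrier = carrier S, monoid.mult = monoid.mult S, one = one S,
    zero = zero S, add = add S, smult = (\<lambda>r x. h r \<otimes>\<^bsub>S\<^esub> x)\<rparr>"

abbreviation self_module :: "('a, 'b) ring_scheme \<Rightarrow> ('a, 'a) module" where
  "self_module R \<equiv> module_via (\<lambda>r. r) R"

abbreviation quot_module :: "('a, 'b) ring_scheme \<Rightarrow> 'a set \<Rightarrow> ('a, 'a set) module" where
  "quot_module R I \<equiv> module_via (a_r_coset R I) (R Quot I)"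

abbreviation quot_grading ::
    "('a, 'b) ring_scheme \<Rightarrow> (nat \<Rightarrow> 'a set) \<Rightarrow> 'a set \<Rightarrow> nat \<Rightarrow> 'a set set" where
  "quot_grading R G I \<equiv> (\<lambda>i. a_r_coset R I ` G i)"

text \<open>Below, \<open>M\<close> is a module over \<open>R\<close> and \<open>N\<close> is its grading.\<close>

definition hilbert_function ::
    "('a, 'b) ring_scheme \<Rightarrow> 'a set \<Rightarrow> ('a, 'm) module \<Rightarrow> (nat \<Rightarrow> 'm set) \<Rightarrow> nat \<Rightarrow> nat" where
  "hilbert_function R K M N i = vectorspace.dim (R\<lparr>carrier := K\<rparr>) (M\<lparr>carrier := N i\<rparr>)"

text \<open>The normalisation uses the Krull dimension of \<open>R\<close>, also for modules of smaller dimension.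
  It is finite for a standard graded algebra, so \<open>the_enat\<close> is harmless there.\<close>

definition hilbert_samuel_multiplicity ::
    "('a, 'b) ring_scheme \<Rightarrow> 'a set \<Rightarrow> ('a, 'm) module \<Rightarrow> (nat \<Rightarrow> 'm set) \<Rightarrow> real" where
  "hilbert_samuel_multiplicity R K M N =
    (let d = the_enat (krull_dim R)
     in lim (\<lambda>t::nat. fact d * (\<Sum>i\<le>t. real (hilbert_function R K M N i)) / real t ^ d))"

definition annihilator :: "('a, 'b) ring_scheme \<Rightarrow> 'a set \<Rightarrow> 'a set" where
  "annihilator R F = {r \<in> carrier R. \<forall>f\<in>F. r \<otimes>\<^bsub>R\<^esub> f = \<zero>\<^bsub>R\<^esub>}"

definition annihilated_families ::
    "('a, 'b) ring_scheme \<Rightarrow> 'a set \<Rightarrow> (nat \<Rightarrow> 'a set) \<Rightarrow> nat \<Rightarrow> nat \<Rightarrow> 'a set set" where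
  "annihilated_families R K G t l = {F. F \<subseteq> G t \<and> finite F \<and> card F = l \<and>
    \<not> module.lin_dep (R\<lparr>carrier := K\<rparr>) (self_module R) F \<and>
    annihilator R F \<noteq> {\<zero>\<^bsub>R\<^esub>}}"

text \<open>The multiplicities \<open>e(R/(F))\<close> are integers bounded by \<open>e(R)\<close>, so the maximum is attained even
  when there are infinitely many families \<open>F\<close>.\<close>

definition gen_min_dist ::
    "('a, 'b) ring_scheme \<Rightarrow> 'a set \<Rightarrow> (nat \<Rightarrow> 'a set) \<Rightarrow> nat \<Rightarrow> nat \<Rightarrow> real" where
  "gen_min_dist R K G t l =
    (let eR = hilbert_samuel_multiplicity R K (self_module R) G;
         eQ = (\<lambda>F. let I = genideal R F in
                 hilbert_samuel_multiplicity R K (quot_module R I) (quot_grading R G I))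
     in if annihilated_families R K G t l \<noteq> {}
        then eR - (GREATEST m. m \<in> eQ ` annihilated_families R K G t l)
        else eR)"

end

theory Submission
  imports Defs
begin

text \<open>Let \<open>V\<close> and \<open>W\<close> be the components of degrees \<open>t\<close> and \<open>t + 1\<close> of the ideal \<open>(F)\<close> of a family
  \<open>F\<close> in \<open>R\<^sub>t\<close>. Since \<open>R\<close> is reduced, \<open>dim V \<le> dim W\<close>, so \<open>W\<close> contains \<open>l\<close> independent elements
  \<open>F'\<close>. As \<open>(F') \<subseteq> (F)\<close>, whatever kills \<open>F\<close> kills \<open>F'\<close>, and \<open>e(R/(F')) \<ge> e(R/(F))\<close>. Hence the
  minimum distance does not increase with \<open>t\<close>; being a natural number, it stabilises.

  That \<open>e(R/I)\<close> is a well-defined natural number for homogeneous \<open>I\<close> requires the dimension theorem: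
  the sums of the Hilbert function of \<open>R/I\<close> grow like \<open>m t\<^sup>n / n!\<close> with an integer \<open>m\<close> and with \<open>n\<close> at most
  the Krull dimension of \<open>R\<close>. Noetherian induction on \<open>I\<close> provides \<open>m\<close>, \<open>n\<close> and a chain of \<open>n + 1\<close>
  primes above \<open>I\<close>. Conversely, a chain of primes of length \<open>n\<close>, homogeneous or not, forces growth of order at
  least \<open>t\<^sup>n\<close>, so the order of growth for \<open>I = 0\<close> is exactly the Krull dimension.\<close>

section \<open>Finite-dimensional subspaces of a vector space\<close>

text \<open>Reducedness is what makes the comparison of dimensions true. For
  \<open>R = K[x]/(x^2)\<close>, where e(R) = 2, the family {x} gives \<delta>(1,1) = 1, but degree
  2 is zero and has no families, so \<delta>(2,1) = 2.

  \<open>lim\<close> and \<open>GREATEST\<close> are informative only once the limit exists and the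
  maximum is attained. Integrality settles the latter: the multiplicities in question are natural
  numbers up to e(R), so there are finitely many of them however many families there are.

  Only leading asymptotics are tracked, no Hilbert polynomials. If a linear form \<open>x\<close> is
  a nonzerodivisor on \<open>R/I\<close>, the Hilbert sums of \<open>R/(I + xR)\<close> are the
  differences of those of \<open>R/I\<close>, and Stolz-Cesaro turns this into a statement on
  growth.

  The Krull dimension is a supremum over chains of arbitrary primes. An inhomogeneous prime may meet
  the single components in too little, so chains are measured by the filtration by degree: the
  elements of degree below \<open>t\<close>, taken modulo the prime.\<close>

context vectorspace
begin

text \<open>The ambient space will be \<open>R\<close> itself, in general of infinite dimension, so
  finiteness is a property of the subspace, viewed as a space of its own.\<close>

definition fin_subspace :: "'c set \<Rightarrow> bool"
  where "fin_subspace U \<longleftrightarrow> subspace K U V \<and> vectorspace.fin_dim K (vs U)"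

abbreviation sdim :: "'c set \<Rightarrow> nat"
  where "sdim U \<equiv> vectorspace.dim K (vs U)"

lemma subspaceI:
  assumes "U \<subseteq> carrier V" "\<zero>\<^bsub>V\<^esub> \<in> U" "\<And>x y. \<lbrakk>x \<in> U; y \<in> U\<rbrakk> \<Longrightarrow> x \<oplus>\<^bsub>V\<^esub> y \<in> U"
    "\<And>c x. \<lbrakk>c \<in> carrier K; x \<in> U\<rbrakk> \<Longrightarrow> c \<odot>\<^bsub>V\<^esub> x \<in> U"
  shows "subspace K U V"
proof -
  have "vectorspace K V" "module K V" by unfold_locales
  then show ?thesis unfolding subspace_def submodule_def using assms by blast
qed

lemma subspaceD:
  assumes "subspace K U V"
  shows "U \<subseteq> carrier V" "\<zero>\<^bsub>V\<^esub> \<in> U" "\<And>x y. \<lbrakk>x \<in> U; y \<in> U\<rbrakk> \<Longrightarrow> x \<oplus>\<^bsub>V\<^esub> y \<in> U"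
    "\<And>c x. \<lbrakk>c \<in> carrier K; x \<in> U\<rbrakk> \<Longrightarrow> c \<odot>\<^bsub>V\<^esub> x \<in> U"
  using assms unfolding subspace_def submodule_def by blast+

lemma subspace_submodule: "subspace K U V \<Longrightarrow> submodule K U V"
  by simp

lemma fin_subspace_span:
  assumes "finite A" "A \<subseteq> carrier V"
  shows "fin_subspace (span A)"
proof -
  have s: "subspace K (span A) V" by (rule span_is_subspace[OF assms(2)])
  interpret U: vectorspace K "vs (span A)" by (rule subspace_is_vs[OF s])
  have "LinearCombinations.module.span K (vs (span A)) A = span A"
    using span_li_not_depend(1)[OF in_own_span[OF assms(2)] subspace_submodule[OF s]] by simp
  then have "U.fin_dim"
    unfolding U.fin_dim_def using assms in_own_span[OF assms(2)] by auto
  with s show ?thesis by (simp add: fin_subspace_def)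
qed

lemma fin_subspaceE:
  assumes "fin_subspace U"
  obtains A where "finite A" "A \<subseteq> carrier V" "span A = U"
proof -
  have s: "subspace K U V" and f: "vectorspace.fin_dim K (vs U)"
    using assms by (auto simp: fin_subspace_def)
  interpret U: vectorspace K "vs U" by (rule subspace_is_vs[OF s])
  obtain A where A: "finite A" "A \<subseteq> U" "LinearCombinations.module.span K (vs U) A = U"
    using f unfolding U.fin_dim_def by auto
  then have "span A = U"
    using span_li_not_depend(1)[OF A(2) subspace_submodule[OF s]] by simp
  with A subspaceD(1)[OF s] that show ?thesis by blast
qed

lemma fin_subspace_sum:
  assumes "fin_subspace U" "fin_subspace W"
  shows "fin_subspace (submodule_sum U W)"
proof -
  obtain A where A: "finite A" "A \<subseteq> carrier V" "span A = U" using assms(1) by (rule fin_subspaceE)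
  obtain B where B: "finite B" "B \<subseteq> carrier V" "span B = W" using assms(2) by (rule fin_subspaceE)
  have "span (A \<union> B) = submodule_sum U W"
    using span_union_is_sum[OF A(2) B(2)] A B by simp
  then show ?thesis using fin_subspace_span[of "A \<union> B"] A B by simp
qed

lemma indep_card_le_sdim:
  assumes "fin_subspace U" "A \<subseteq> U" "lin_indpt A"
  shows "finite A" "card A \<le> sdim U"
proof -
  have s: "subspace K U V" and f: "vectorspace.fin_dim K (vs U)"
    using assms by (auto simp: fin_subspace_def)
  interpret U: vectorspace K "vs U" by (rule subspace_is_vs[OF s])
  have "U.lin_indpt A"
    using span_li_not_depend(2)[OF assms(2) subspace_submodule[OF s]] assms(3) by simp
  then show "finite A" "card A \<le> sdim U" using U.li_le_dim[OF f] assms(2) by auto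
qed

text \<open>Independent sets inside \<open>W\<close> also lie in \<open>U\<close>, so
  \<open>sdim U\<close> bounds their size and a maximal one exists; it is a basis of
  \<open>W\<close>. Finite dimension of \<open>W\<close> is thus a conclusion.\<close>

lemma basis_of_subspace:
  assumes "fin_subspace U" "W \<subseteq> U" "subspace K W V"
  obtains A where "finite A" "A \<subseteq> W" "lin_indpt A" "span A = W" "card A = sdim W" "fin_subspace W"
proof -
  interpret W: vectorspace K "vs W" by (rule subspace_is_vs[OF assms(3)])
  note dep = span_li_not_depend[OF _ subspace_submodule[OF assms(3)]]
  have bound: "finite A \<and> card A \<le> sdim U" if "A \<subseteq> carrier (vs W) \<and> W.lin_indpt A" for A
    using indep_card_le_sdim[OF assms(1), of A] dep(2)[of A] that assms(2) by auto
  have "\<exists>A. finite A \<and> maximal A (\<lambda>S. S \<subseteq> carrier (vs W) \<and> W.lin_indpt S)"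
  proof (rule maximal_exists[OF bound])
    show "{} \<subseteq> carrier (vs W) \<and> W.lin_indpt {}" by (simp add: W.lin_dep_def)
  qed
  then obtain A where A: "finite A" "W.basis A" using W.max_li_is_basis by auto
  have "A \<subseteq> W" "lin_indpt A" "span A = W"
    using A dep[of A] unfolding W.basis_def by auto
  moreover have "card A = sdim W" using W.dim_basis[OF A] by simp
  moreover have "fin_subspace W" unfolding fin_subspace_def W.fin_dim_def
    using A assms(3) unfolding W.basis_def by blast
  ultimately show ?thesis using that A(1) by blast
qed

lemma fin_subspace_subset:
  assumes "fin_subspace U" "W \<subseteq> U" "subspace K W V"
  shows "fin_subspace W" "sdim W \<le> sdim U"
proof -
  obtain A where A: "finite A" "A \<subseteq> W" "lin_indpt A" "span A = W" "card A = sdim W" "fin_subspace W"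
    using basis_of_subspace[OF assms] .
  show "fin_subspace W" by (rule A(6))
  show "sdim W \<le> sdim U" using indep_card_le_sdim[OF assms(1), of A] A assms(2) by auto
qed

lemma sdim_psubset:
  assumes "fin_subspace U" "W \<subset> U" "subspace K W V"
  shows "sdim W < sdim U"
proof -
  obtain A where A: "finite A" "A \<subseteq> W" "lin_indpt A" "span A = W" "card A = sdim W" "fin_subspace W"
    using basis_of_subspace[OF assms(1) _ assms(3)] assms(2) by blast
  obtain v where v: "v \<in> U" "v \<notin> W" using assms(2) by blast
  have c: "A \<subseteq> carrier V" "v \<in> carrier V"
    using A(2) subspaceD(1)[OF assms(3)] v(1) assms(1) subspaceD(1)[of U] by (auto simp: fin_subspace_def)
  have "v \<notin> A" using v A by blast
  then have "lin_indpt (A \<union> {v})"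
    using lin_dep_iff_in_span[OF c(1) A(3) c(2)] A(4) v(2) by blast
  then have "card (A \<union> {v}) \<le> sdim U"
    using indep_card_le_sdim[OF assms(1), of "A \<union> {v}"] A(2) assms(2) v(1) by blast
  then show ?thesis using A(1,5) \<open>v \<notin> A\<close> by simp
qed

lemma exists_indep_subset:
  assumes "fin_subspace U" "l \<le> sdim U"
  obtains F where "F \<subseteq> U" "finite F" "card F = l" "lin_indpt F"
proof -
  obtain A where A: "finite A" "A \<subseteq> U" "lin_indpt A" "card A = sdim U"
    using basis_of_subspace[OF assms(1) order_refl] assms(1) unfolding fin_subspace_def by metis
  obtain F where "F \<subseteq> A" "card F = l" using obtain_subset_with_card_n[of l A] A assms(2) by auto
  then show ?thesis using that[of F] A subset_li_is_li[OF A(3)] finite_subset by blast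
qed

lemma sdim_zero: "fin_subspace {\<zero>\<^bsub>V\<^esub>}" "sdim {\<zero>\<^bsub>V\<^esub>} = 0"
proof -
  show f: "fin_subspace {\<zero>\<^bsub>V\<^esub>}" using fin_subspace_span[of "{}"] unfolding span_empty by blast
  have "subspace K {\<zero>\<^bsub>V\<^esub>} V" using f by (simp add: fin_subspace_def)
  then obtain A where A: "A \<subseteq> {\<zero>\<^bsub>V\<^esub>}" "lin_indpt A" "card A = sdim {\<zero>\<^bsub>V\<^esub>}"
    by (rule basis_of_subspace[OF f order_refl])
  have "\<zero>\<^bsub>V\<^esub> \<notin> A"
    by (rule vs_zero_lin_dep[OF _ A(2)]) (use A(1) in auto)
  then have "A = {}" using A(1) by blast
  then show "sdim {\<zero>\<^bsub>V\<^esub>} = 0" using A(3) by simp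
qed

lemma module_hom_zero:
  assumes "vectorspace K W" "T \<in> module_hom K V W"
  shows "T \<zero>\<^bsub>V\<^esub> = \<zero>\<^bsub>W\<^esub>"
proof -
  have "module K V" by unfold_locales
  then have "mod_hom K V W T"
    using assms by (simp add: mod_hom_def mod_hom_axioms_def vectorspace_def)
  then show ?thesis by (rule mod_hom.f0_is_0)
qed

lemma rank_nullity_on:
  assumes "vectorspace K W" "T \<in> module_hom K V W" "fin_subspace U"
  shows "vectorspace.fin_subspace K W (T ` U)"
    "vectorspace.dim K (W\<lparr>carrier := T ` U\<rparr>) + sdim {y \<in> U. T y = \<zero>\<^bsub>W\<^esub>} = sdim U"
proof -
  interpret W: vectorspace K W by fact
  have s: "subspace K U V" and f: "vectorspace.fin_dim K (vs U)"
    using assms(3) by (auto simp: fin_subspace_def)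
  interpret U: vectorspace K "vs U" by (rule subspace_is_vs[OF s])
  have h: "T \<in> module_hom K (vs U) W"
    using assms(2) subspaceD(1)[OF s] by (simp add: module_hom_def subset_iff Pi_iff)
  interpret T: linear_map K "vs U" W T
    by (intro linear_map.intro mod_hom.intro mod_hom_axioms.intro h) unfold_locales
  have im: "T.imT = T ` U" by (simp add: T.im_def)
  have sW: "subspace K (T ` U) W" using T.imT_is_subspace unfolding im .
  interpret I: vectorspace K "W.vs (T ` U)" by (rule W.subspace_is_vs[OF sW])
  have h': "T \<in> module_hom K (vs U) (W.vs (T ` U))"
    using h by (auto simp: module_hom_def)
  interpret T': linear_map K "vs U" "W.vs (T ` U)" T
    by (intro linear_map.intro mod_hom.intro mod_hom_axioms.intro h') unfold_locales
  show "W.fin_subspace (T ` U)"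
    using T'.rank_nullity_main(2)[OF f] sW by (simp add: W.fin_subspace_def)
  show "vectorspace.dim K (W\<lparr>carrier := T ` U\<rparr>) + sdim {y \<in> U. T y = \<zero>\<^bsub>W\<^esub>} = sdim U"
    using T.rank_nullity[OF f] by (simp add: im T.ker_def)
qed

lemma sdim_inj_image:
  assumes "vectorspace K W" "T \<in> module_hom K V W" "fin_subspace U"
    "\<And>y. \<lbrakk>y \<in> U; T y = \<zero>\<^bsub>W\<^esub>\<rbrakk> \<Longrightarrow> y = \<zero>\<^bsub>V\<^esub>"
  shows "vectorspace.dim K (W\<lparr>carrier := T ` U\<rparr>) = sdim U"
proof -
  have U: "\<zero>\<^bsub>V\<^esub> \<in> U" using subspaceD(2)[of U] assms(3) by (simp add: fin_subspace_def)
  have "T \<zero>\<^bsub>V\<^esub> = \<zero>\<^bsub>W\<^esub>" by (rule module_hom_zero[OF assms(1,2)])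
  then have "{y \<in> U. T y = \<zero>\<^bsub>W\<^esub>} = {\<zero>\<^bsub>V\<^esub>}" using assms(4) U by blast
  then show ?thesis using rank_nullity_on(2)[OF assms(1-3)] by (simp only: sdim_zero(2) add_0_right)
qed

text \<open>Rank-nullity for the map \<open>(y, b) \<mapsto> T y + b\<close> on the external direct
  sum of \<open>U\<close> and \<open>B\<close>. Its kernel consists of the pairs
  \<open>(y, - T y)\<close> with \<open>T y\<close> in \<open>B\<close>, so projecting to
  \<open>y\<close> identifies it with the subspace in the second summand.\<close>

lemma sdim_image_sum:
  assumes T: "T \<in> module_hom K V V" and U: "fin_subspace U" and B: "fin_subspace B"
  shows "fin_subspace {T y \<oplus>\<^bsub>V\<^esub> b |y b. y \<in> U \<and> b \<in> B}"
    "sdim {T y \<oplus>\<^bsub>V\<^esub> b |y b. y \<in> U \<and> b \<in> B} + sdim {y \<in> U. T y \<in> B} = sdim U + sdim B"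
proof -
  have vV: "vectorspace K V" by unfold_locales
  define D where "D = direct_sum (vs U) (vs B)"
  have sU: "subspace K U V" and sB: "subspace K B V"
    using U B by (auto simp: fin_subspace_def)
  note Us = subspaceD[OF sU] and Bs = subspaceD[OF sB]
  have vU: "vectorspace K (vs U)" and vB: "vectorspace K (vs B)"
    using subspace_is_vs sU sB by auto
  have vD: "vectorspace K D" unfolding D_def by (rule direct_sum_is_vs[OF vU vB])
  have mD: "module K D" using vD by (simp add: vectorspace_def)
  have "subspace K U (vs U)" "subspace K B (vs B)"
    using vectorspace.subspaceI[OF vU, of U] vectorspace.subspaceI[OF vB, of B] Us Bs by simp_all
  then have fU: "vectorspace.fin_subspace K (vs U) U" and fB: "vectorspace.fin_subspace K (vs B) B"
    using U B by (simp_all add: fin_subspace_def vectorspace.fin_subspace_def[OF vU]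
        vectorspace.fin_subspace_def[OF vB])
  define f g where "f = (\<lambda>v::'c. (v, \<zero>\<^bsub>V\<^esub>))" and "g = (\<lambda>v::'c. (\<zero>\<^bsub>V\<^esub>, v))"
  have h1: "f \<in> module_hom K (vs U) D" and h2: "g \<in> module_hom K (vs B) D"
    using Us Bs smult_r_null by (auto simp: module_hom_def D_def direct_sum_def f_def g_def subset_iff)
  have f1: "vectorspace.fin_subspace K D (f ` U)" using vectorspace.rank_nullity_on(1)[OF vU vD h1 fU] .
  have f2: "vectorspace.fin_subspace K D (g ` B)" using vectorspace.rank_nullity_on(1)[OF vB vD h2 fB] .
  have cD: "carrier D = U \<times> B" by (simp add: D_def direct_sum_def)
  have "LinearCombinations.module.submodule_sum D (f ` U) (g ` B) = U \<times> B"
  proof -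
    have eq: "f u \<oplus>\<^bsub>D\<^esub> g b = (u, b)" if "u \<in> U" "b \<in> B" for u b
      using that Us Bs by (simp add: D_def direct_sum_def f_def g_def subset_iff)
    have "LinearCombinations.module.submodule_sum D (f ` U) (g ` B) = (\<lambda>(u, b). f u \<oplus>\<^bsub>D\<^esub> g b) ` (U \<times> B)"
    proof -
      have "{(x, y). x \<in> f ` U \<and> y \<in> g ` B} = (\<lambda>(u, b). (f u, g b)) ` (U \<times> B)"
        by auto
      then show ?thesis
        unfolding LinearCombinations.module.submodule_sum_def[OF mD] by (simp only: image_image case_prod_unfold fst_conv snd_conv)
    qed
    also have "\<dots> = (\<lambda>p. p) ` (U \<times> B)"
      by (rule image_cong) (auto simp: eq)
    finally show ?thesis by simp
  qed
  then have fD: "vectorspace.fin_subspace K D (U \<times> B)" using vectorspace.fin_subspace_sum[OF vD f1 f2] by simp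
  have zD: "\<zero>\<^bsub>D\<^esub> = (\<zero>\<^bsub>V\<^esub>, \<zero>\<^bsub>V\<^esub>)" by (simp add: D_def direct_sum_def)
  \<comment> \<open>The dimension of \<open>U \<times> B\<close> also comes from rank-nullity,
    applied to the first projection: its kernel is a copy of \<open>B\<close>.\<close>
  have hfst: "fst \<in> module_hom K D V"
    using Us Bs by (auto simp: module_hom_def D_def direct_sum_def subset_iff)
  have dB: "vectorspace.dim K (D\<lparr>carrier := (g ` B)\<rparr>) = sdim B"
    using vectorspace.sdim_inj_image[OF vB vD h2 fB] by (simp add: g_def zD)
  have "fst ` (U \<times> B) = U" using Bs(2) by force
  moreover have "{y \<in> U \<times> B. fst y = \<zero>\<^bsub>V\<^esub>} = g ` B" using Us(2) by (auto simp: g_def)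
  ultimately have dD: "sdim U + sdim B = vectorspace.dim K (D\<lparr>carrier := (U \<times> B)\<rparr>)"
    using vectorspace.rank_nullity_on(2)[OF vD vV hfst fD] dB by simp
  have Tc: "T y \<in> carrier V" if "y \<in> U" for y
    using T Us(1) that by (auto simp: module_hom_def)
  define S where "S = (\<lambda>p. T (fst p) \<oplus>\<^bsub>V\<^esub> snd p)"
  have Bc: "b \<in> carrier V" if "b \<in> B" for b using Bs(1) that by blast
  have hS: "S \<in> module_hom K D V"
  proof -
    have "S (p \<oplus>\<^bsub>D\<^esub> q) = S p \<oplus>\<^bsub>V\<^esub> S q" if "p \<in> U \<times> B" "q \<in> U \<times> B" for p q
    proof -
      have "T (fst p \<oplus>\<^bsub>V\<^esub> fst q) = T (fst p) \<oplus>\<^bsub>V\<^esub> T (fst q)"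
        using module_hom_add[OF T] Us(1) that by (metis mem_Times_iff subsetD)
      then show ?thesis
        using that by (simp add: S_def D_def direct_sum_def mem_Times_iff Tc Bc M.a_assoc M.a_lcomm)
    qed
    moreover have "S (c \<odot>\<^bsub>D\<^esub> p) = c \<odot>\<^bsub>V\<^esub> S p" if "c \<in> carrier K" "p \<in> U \<times> B" for c p
    proof -
      have "T (c \<odot>\<^bsub>V\<^esub> fst p) = c \<odot>\<^bsub>V\<^esub> T (fst p)"
        using module_hom_smult[OF T] Us(1) that by (metis mem_Times_iff subsetD)
      then show ?thesis
        using that by (simp add: S_def D_def direct_sum_def mem_Times_iff Tc Bc smult_r_distr)
    qed
    moreover have "S p \<in> carrier V" if "p \<in> U \<times> B" for p
      using that by (simp add: S_def mem_Times_iff Tc Bc)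
    ultimately show ?thesis unfolding module_hom_def cD by blast
  qed
  have im: "S ` (U \<times> B) = {T y \<oplus>\<^bsub>V\<^esub> b |y b. y \<in> U \<and> b \<in> B}"
    by (force simp: S_def)
  show "fin_subspace {T y \<oplus>\<^bsub>V\<^esub> b |y b. y \<in> U \<and> b \<in> B}"
    using vectorspace.rank_nullity_on(1)[OF vD vV hS fD] unfolding im .
  let ?N = "{p \<in> U \<times> B. S p = \<zero>\<^bsub>V\<^esub>}"
  have mh: "mod_hom K D V S"
    using hS vD vV by (simp add: mod_hom_def mod_hom_axioms_def vectorspace_def)
  have "submodule K ?N D"
    using mod_hom.ker_is_submodule[OF mh] by (simp only: mod_hom.ker_def[OF mh] cD)
  then have sN: "subspace K ?N D" using vD by (simp add: subspace_def)
  have fN: "vectorspace.fin_subspace K D ?N" by (rule vectorspace.fin_subspace_subset(1)[OF vD fD _ sN]) auto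
  have neg: "\<ominus>\<^bsub>V\<^esub> b \<in> B" if "b \<in> B" for b
  proof -
    have "\<ominus>\<^bsub>V\<^esub> b = (\<ominus>\<^bsub>K\<^esub> \<one>\<^bsub>K\<^esub>) \<odot>\<^bsub>V\<^esub> b"
      using smult_l_minus[of "\<one>\<^bsub>K\<^esub>" b] Bc[OF that] by (simp add: R.one_closed)
    then show ?thesis using Bs(4)[of "\<ominus>\<^bsub>K\<^esub> \<one>\<^bsub>K\<^esub>" b] that by (simp add: R.one_closed)
  qed
  have eq: "fst ` ?N = {y \<in> U. T y \<in> B}"
  proof (intro equalityI subsetI)
    fix y assume "y \<in> fst ` ?N"
    then obtain b where b: "y \<in> U" "b \<in> B" "T y \<oplus>\<^bsub>V\<^esub> b = \<zero>\<^bsub>V\<^esub>" by (auto simp: S_def)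
    then have "T y = \<ominus>\<^bsub>V\<^esub> b" using M.minus_equality[OF b(3) Bc Tc] by simp
    then show "y \<in> {y \<in> U. T y \<in> B}" using b neg by simp
  next
    fix y assume y: "y \<in> {y \<in> U. T y \<in> B}"
    then have "(y, \<ominus>\<^bsub>V\<^esub> T y) \<in> ?N" using neg Tc by (simp add: S_def M.r_neg)
    then show "y \<in> fst ` ?N" by force
  qed
  have "sdim (fst ` ?N) = vectorspace.dim K (D\<lparr>carrier := ?N\<rparr>)"
  proof (rule vectorspace.sdim_inj_image[OF vD vV hfst fN])
    fix p assume p: "p \<in> ?N" "fst p = \<zero>\<^bsub>V\<^esub>"
    have "snd p \<in> carrier V" using p Bs(1) by auto
    then have "snd p = \<zero>\<^bsub>V\<^esub>" using p module_hom_zero[OF vV T] by (auto simp: S_def)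
    then show "p = \<zero>\<^bsub>D\<^esub>" using p(2) by (simp add: zD prod_eq_iff)
  qed
  then show "sdim {T y \<oplus>\<^bsub>V\<^esub> b |y b. y \<in> U \<and> b \<in> B} + sdim {y \<in> U. T y \<in> B} = sdim U + sdim B"
    using vectorspace.rank_nullity_on(2)[OF vD vV hS fD] dD by (simp add: im eq)
qed

end

section \<open>Growth of sequences\<close>

text \<open>Says that \<open>f t\<close> behaves like \<open>m t^d / d!\<close>. The value
  \<open>m = 0\<close> is allowed and means only that \<open>f\<close> grows more slowly than
  \<open>t^d\<close>; this is how quotients of smaller dimension get multiplicity zero.\<close>

definition has_growth :: "(nat \<Rightarrow> real) \<Rightarrow> nat \<Rightarrow> real \<Rightarrow> bool"
  where "has_growth f d m \<longleftrightarrow> (\<lambda>t. fact d * f t / real t ^ d) \<longlonglongrightarrow> m"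

lemma stolz_cesaro:
  fixes f b :: "nat \<Rightarrow> real"
  assumes b: "strict_mono b" "filterlim b at_top sequentially"
    and lim: "(\<lambda>n. (f (Suc n) - f n) / (b (Suc n) - b n)) \<longlonglongrightarrow> L"
  shows "(\<lambda>n. f n / b n) \<longlonglongrightarrow> L"
proof (rule LIMSEQ_I)
  fix e :: real assume e: "0 < e"
  \<comment> \<open>Subtracting \<open>L b\<close> reduces to limit zero: the increments of
    \<open>h\<close> are eventually at most \<open>e/2\<close> times those of \<open>b\<close>, and
    they telescope.\<close>
  define h where "h n = f n - L * b n" for n
  have pos: "0 < b (Suc n) - b n" for n
    using b(1) by (simp add: strict_mono_Suc_iff)
  obtain N where N: "\<And>n. n \<ge> N \<Longrightarrow> norm ((f (Suc n) - f n) / (b (Suc n) - b n) - L) < e / 2"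
    using LIMSEQ_D[OF lim, of "e / 2"] e by auto
  have st: "\<bar>h (Suc n) - h n\<bar> \<le> e / 2 * (b (Suc n) - b n)" if "n \<ge> N" for n
  proof -
    have "h (Suc n) - h n = ((f (Suc n) - f n) / (b (Suc n) - b n) - L) * (b (Suc n) - b n)"
      using pos[of n] by (simp add: h_def field_simps)
    then show ?thesis
      using N[OF that] pos[of n] by (simp add: abs_mult)
  qed
  have bound: "\<bar>h n\<bar> \<le> \<bar>h N\<bar> + e / 2 * (b n - b N)" if "n \<ge> N" for n
    using that
  proof (induction n rule: dec_induct)
    case (step n)
    have "\<bar>h (Suc n)\<bar> \<le> \<bar>h n\<bar> + \<bar>h (Suc n) - h n\<bar>" by linarith
    also have "\<dots> \<le> (\<bar>h N\<bar> + e / 2 * (b n - b N)) + e / 2 * (b (Suc n) - b n)"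
      using step st[of n] by (intro add_mono) auto
    also have "\<dots> = \<bar>h N\<bar> + e / 2 * (b (Suc n) - b N)" by (simp add: right_diff_distrib)
    finally show ?case .
  qed simp
  \<comment> \<open>From \<open>M\<close> on, the part of the bound that is constant in
    \<open>n\<close> is below \<open>e/2 * b n\<close>, the other half of the allowed error.\<close>
  have "eventually (\<lambda>n. b n > max 0 ((\<bar>h N\<bar> - e / 2 * b N) * 2 / e)) sequentially"
    using b(2) unfolding filterlim_at_top_dense by blast
  then obtain M where M: "\<And>n. n \<ge> M \<Longrightarrow> b n > max 0 ((\<bar>h N\<bar> - e / 2 * b N) * 2 / e)"
    by (auto simp: eventually_sequentially)
  show "\<exists>no. \<forall>n\<ge>no. norm (f n / b n - L) < e"
  proof (intro exI allI impI)
    fix n assume n: "n \<ge> max M N"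
    then have bn: "b n > 0" "\<bar>h N\<bar> - e / 2 * b N < e / 2 * b n"
      using M[of n] e by (auto simp: field_simps)
    have "e * b n = e / 2 * b n + e / 2 * b n" "e / 2 * (b n - b N) = e / 2 * b n - e / 2 * b N"
      by (simp_all add: right_diff_distrib)
    then have "\<bar>h n\<bar> < e * b n" using bound[of n] n bn(2) by linarith
    moreover have "f n / b n - L = h n / b n" using bn(1) by (simp add: h_def field_simps)
    ultimately show "norm (f n / b n - L) < e"
      using bn(1) by (simp add: field_simps)
  qed
qed

text \<open>Put \<open>q = n / (n + 1)\<close>. As \<open>(n + 1) (1 - q) = 1\<close>, the quotient
  is the geometric sum \<open>1 + q + ... + q^d\<close>, and \<open>q\<close> tends to 1.\<close>

lemma tendsto_power_diff_quotient:
  "(\<lambda>n. (real (Suc n) ^ Suc d - real n ^ Suc d) / real (Suc n) ^ d) \<longlonglongrightarrow> real (Suc d)"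
proof -
  have q: "(\<lambda>n. real n / real (Suc n)) \<longlonglongrightarrow> 1" by (rule LIMSEQ_n_over_Suc_n)
  have "(\<lambda>n. \<Sum>i<Suc d. (real n / real (Suc n)) ^ i) \<longlonglongrightarrow> (\<Sum>i<Suc d. 1 ^ i)"
    by (intro tendsto_intros q)
  moreover have "(\<Sum>i<Suc d. (real n / real (Suc n)) ^ i)
      = (real (Suc n) ^ Suc d - real n ^ Suc d) / real (Suc n) ^ d" for n
  proof -
    define q where "q = real n / real (Suc n)"
    have "(1 - q) * real (Suc n) = 1" by (simp add: q_def field_simps)
    then have "real (Suc n) * (1 - q ^ Suc d) = (\<Sum>i<Suc d. q ^ i)"
      unfolding one_diff_power_eq[of q "Suc d"] by (metis mult.assoc mult.commute mult_1)
    then have "(\<Sum>i<Suc d. q ^ i) = real (Suc n) * (1 - q ^ Suc d)" ..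
    also have "\<dots> = (real (Suc n) ^ Suc d - real n ^ Suc d) / real (Suc n) ^ d"
      by (simp add: q_def power_divide field_simps del: of_nat_Suc)
    finally show ?thesis by (simp add: q_def)
  qed
  ultimately show ?thesis by simp
qed

text \<open>Stolz-Cesaro against \<open>n^(d+1)\<close> gives the quotient
  \<open>m / (d + 1)\<close>, and passing from \<open>d!\<close> to \<open>(d + 1)!\<close> cancels
  exactly this factor. An integer \<open>m\<close> therefore stays the same integer while the order
  rises by one.\<close>

lemma has_growth_sum:
  assumes diff: "\<And>t. f (Suc t) - f t = g (Suc t)" and g: "has_growth g d m"
  shows "has_growth f (Suc d) m"
proof -
  let ?b = "\<lambda>n. real n ^ Suc d"
  have mono: "strict_mono ?b"
    by (rule strict_mono_onI) (auto intro: power_strict_mono simp del: power_Suc)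
  have inf: "filterlim ?b at_top sequentially"
    by (rule filterlim_pow_at_top) (auto intro: filterlim_real_sequentially)
  have "(\<lambda>n. fact d * g (Suc n) / real (Suc n) ^ d) \<longlonglongrightarrow> m"
    using g unfolding has_growth_def by (rule LIMSEQ_Suc)
  then have "(\<lambda>n. (fact d * g (Suc n) / real (Suc n) ^ d) /
      ((real (Suc n) ^ Suc d - real n ^ Suc d) / real (Suc n) ^ d)) \<longlonglongrightarrow> m / real (Suc d)"
    by (intro tendsto_divide tendsto_power_diff_quotient) (simp_all del: of_nat_Suc)
  moreover have "(fact d * g (Suc n) / real (Suc n) ^ d) /
      ((real (Suc n) ^ Suc d - real n ^ Suc d) / real (Suc n) ^ d)
      = (fact d * f (Suc n) - fact d * f n) / (?b (Suc n) - ?b n)" for n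
    using diff[of n] by (simp del: power_Suc of_nat_Suc add: right_diff_distrib[symmetric])
  ultimately have "(\<lambda>n. (fact d * f (Suc n) - fact d * f n) / (?b (Suc n) - ?b n)) \<longlonglongrightarrow> m / real (Suc d)"
    by (simp only:)
  from stolz_cesaro[OF mono inf this]
  have "(\<lambda>n. real (Suc d) * (fact d * f n / ?b n)) \<longlonglongrightarrow> real (Suc d) * (m / real (Suc d))"
    by (intro tendsto_mult_left)
  then show ?thesis by (simp add: has_growth_def mult.assoc del: of_nat_Suc power_Suc)
qed

text \<open>Serves the degree shift that comes with multiplication by an element of degree
  \<open>a\<close>. The ratio \<open>(n / (n + a))^d\<close> tends to 1, and truncation of
  \<open>t - a\<close> concerns finitely many \<open>t\<close> only.\<close>

lemma has_growth_shift:
  assumes "has_growth f d m"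
  shows "has_growth (\<lambda>t. f (t - a)) d m"
proof -
  have r: "(\<lambda>n. real n / real (n + a)) \<longlonglongrightarrow> 1"
  proof -
    have "(\<lambda>n. 1 - real a * inverse (real (n + a))) \<longlonglongrightarrow> 1 - real a * 0"
      by (intro tendsto_intros LIMSEQ_ignore_initial_segment[OF lim_inverse_n])
    moreover have "eventually (\<lambda>n. 1 - real a * inverse (real (n + a)) = real n / real (n + a)) sequentially"
      using eventually_gt_at_top[of 0] by eventually_elim (simp add: field_simps)
    ultimately show ?thesis using filterlim_cong by fastforce
  qed
  have "(\<lambda>n. fact d * f n / real n ^ d * (real n / real (n + a)) ^ d) \<longlonglongrightarrow> m * 1 ^ d"
    using assms unfolding has_growth_def by (intro tendsto_intros r)
  moreover have "eventually (\<lambda>n. fact d * f n / real n ^ d * (real n / real (n + a)) ^ d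
      = fact d * f (n + a - a) / real (n + a) ^ d) sequentially"
    using eventually_gt_at_top[of 0] by eventually_elim (simp add: power_divide)
  ultimately have "(\<lambda>n. fact d * f (n + a - a) / real (n + a) ^ d) \<longlonglongrightarrow> m"
    using Lim_transform_eventually by fastforce
  then show ?thesis unfolding has_growth_def by (rule LIMSEQ_offset)
qed

lemma has_growth_less:
  assumes "has_growth f d m" "d < d'"
  shows "has_growth f d' 0"
proof -
  have "(\<lambda>t. (fact d' / fact d) * (fact d * f t / real t ^ d) * (inverse (real t)) ^ (d' - d))
      \<longlonglongrightarrow> (fact d' / fact d) * m * 0 ^ (d' - d)"
    using assms(1) unfolding has_growth_def by (intro tendsto_intros lim_inverse_n)
  moreover have "eventually (\<lambda>t. (fact d' / fact d) * (fact d * f t / real t ^ d) * (inverse (real t)) ^ (d' - d)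
      = fact d' * f t / real t ^ d') sequentially"
    using eventually_gt_at_top[of 0]
  proof eventually_elim
    case (elim t)
    have "real t ^ d' = real t ^ d * real t ^ (d' - d)"
      using assms(2) by (simp flip: power_add)
    then show ?case using elim by (simp add: field_simps)
  qed
  ultimately have "(\<lambda>t. fact d' * f t / real t ^ d') \<longlonglongrightarrow> (fact d' / fact d) * m * 0 ^ (d' - d)"
    (is "?X \<longlonglongrightarrow> _") by (rule Lim_transform_eventually)
  then show ?thesis using assms(2) by (simp add: has_growth_def power_0_left)
qed

lemma has_growth_add:
  assumes "has_growth f d m" "has_growth g d n"
  shows "has_growth (\<lambda>t. f t + g t) d (m + n)"
  using tendsto_add[OF assms[unfolded has_growth_def]]
  by (simp add: has_growth_def distrib_left add_divide_distrib)

lemma has_growth_cong: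
  assumes "eventually (\<lambda>t. f t = g t) sequentially" "has_growth f d m"
  shows "has_growth g d m"
proof -
  have "eventually (\<lambda>t. fact d * f t / real t ^ d = fact d * g t / real t ^ d) sequentially"
    using assms(1) by eventually_elim simp
  with assms(2) show ?thesis unfolding has_growth_def by (rule Lim_transform_eventually)
qed

text \<open>Iterating \<open>step\<close> from \<open>s\<close> to \<open>s + j a\<close> collects
  \<open>j\<close> values of \<open>B\<close>, each at least \<open>c s^n\<close>. With
  \<open>j\<close> and \<open>s\<close> both proportional to \<open>t\<close> this has order
  \<open>t^(n+1)\<close>.\<close>

lemma power_lower_bound_step:
  fixes A B :: "nat \<Rightarrow> real"
  assumes a: "a \<ge> 1" and A: "\<And>t. A t \<ge> 0" and step: "\<And>t. A (t + a) \<ge> B (t + a) + A t"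
    and B: "c > 0" "\<And>t. t \<ge> T \<Longrightarrow> B t \<ge> c * real t ^ n"
  shows "\<exists>c'>0. \<exists>T'. \<forall>t\<ge>T'. A t \<ge> c' * real t ^ Suc n"
proof -
  have iter: "A (s + j * a) \<ge> real j * (c * real s ^ n)" if "s \<ge> T" for s j
  proof (induction j)
    case (Suc j)
    have "c * real s ^ n \<le> c * real (s + Suc j * a) ^ n"
      using B(1) by (intro mult_left_mono power_mono) auto
    also have "\<dots> \<le> B (s + Suc j * a)" using that by (intro B(2)) auto
    finally show ?case
      using step[of "s + j * a"] Suc.IH by (simp add: algebra_simps)
  qed (use A in simp)
  \<comment> \<open>For \<open>j = t div (2 a)\<close> and \<open>s = t - j a\<close> one has
    \<open>s \<ge> t/2\<close>, and \<open>j \<ge> t/(4 a)\<close> as soon as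
    \<open>t \<ge> 4 a\<close>; multiplying these bounds yields \<open>c'\<close>. The condition
    \<open>t \<ge> 2 T\<close> keeps \<open>s\<close> at or above \<open>T\<close>.\<close>
  define c' where "c' = c / (4 * real a * 2 ^ n)"
  have "A t \<ge> c' * real t ^ Suc n" if t: "t \<ge> max (2 * T) (4 * a)" for t
  proof -
    define j where "j = t div (2 * a)"
    define s where "s = t - j * a"
    have tj: "t = 2 * (a * j) + t mod (2 * a)"
      using div_mult_mod_eq[of t "2 * a"] by (simp add: j_def ac_simps)
    then have "2 * (j * a) \<le> t" by (simp add: mult.commute[of j a])
    then have s: "2 * s \<ge> t" "s + j * a = t" "s \<ge> T" using t by (auto simp: s_def)
    have "t mod (2 * a) < 2 * a" using a by simp
    then have "t \<le> 4 * (a * j)" using tj t by linarith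
    then have "real t \<le> real (4 * (a * j))" by (rule of_nat_mono)
    then have j: "real t / (4 * real a) \<le> real j"
      using a by (simp add: field_simps)
    have "c' * real t ^ Suc n = real t / (4 * real a) * (c * (real t / 2) ^ n)"
      by (simp add: c'_def power_divide)
    also have "\<dots> \<le> real j * (c * real s ^ n)"
      using j B(1) s(1) by (intro mult_mono power_mono mult_nonneg_nonneg) auto
    also have "\<dots> \<le> A t" using iter[OF s(3), of j] s(2) by simp
    finally show ?thesis .
  qed
  moreover have "c' > 0" using a B(1) by (simp add: c'_def)
  ultimately show ?thesis by blast
qed

lemma has_growth_degree_ge:
  assumes f: "has_growth f d m" and c: "c > 0" and le: "\<And>t. t \<ge> T \<Longrightarrow> c * real t ^ n \<le> f t"
  shows "n \<le> d"
proof (rule ccontr)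
  assume "\<not> n \<le> d"
  then have "(\<lambda>t. fact n * f t / real t ^ n) \<longlonglongrightarrow> 0"
    using has_growth_less[OF f] by (simp add: has_growth_def)
  moreover have "eventually (\<lambda>t. fact n * c \<le> fact n * f t / real t ^ n) sequentially"
    using eventually_ge_at_top[of "max T 1"]
    by eventually_elim (use le in \<open>simp add: pos_le_divide_eq mult.assoc\<close>)
  ultimately have "fact n * c \<le> 0" by (rule tendsto_lowerbound) simp
  then show False using c by (metis fact_gt_zero mult_pos_pos not_less)
qed

section \<open>Subspaces of an algebra over a subfield\<close>

locale subfield_algebra = cring R for R :: "('a, 'b) ring_scheme" (structure) +
  fixes K :: "'a set"
  assumes subfield: "subfield K R"
begin

definition K_subspace :: "'a set \<Rightarrow> bool"
  where "K_subspace U \<longleftrightarrow> U \<subseteq> carrier R \<and> \<zero> \<in> U \<and> (\<forall>x\<in>U. \<forall>y\<in>U. x \<oplus> y \<in> U) \<and> (\<forall>c\<in>K. \<forall>x\<in>U. c \<otimes> x \<in> U)"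

definition fin_dim_subspace :: "'a set \<Rightarrow> bool"
  where "fin_dim_subspace = vectorspace.fin_subspace (R\<lparr>carrier := K\<rparr>) (self_module R)"

definition kdim :: "'a set \<Rightarrow> nat"
  where "kdim U = vectorspace.dim (R\<lparr>carrier := K\<rparr>) (self_module R\<lparr>carrier := U\<rparr>)"

lemma K_subset: "K \<subseteq> carrier R"
  using subfieldE(3)[OF subfield] .

lemma one_K: "\<one> \<in> K"
  using subringE(3)[OF subfieldE(1)[OF subfield]] .

lemma one_not_zero: "\<one> \<noteq> \<zero>"
  using subfieldE(6)[OF subfield] .

lemma neg_K: "c \<in> K \<Longrightarrow> \<ominus> c \<in> K"
  using subringE(5)[OF subfieldE(1)[OF subfield]] .

lemma K_field: "field (R\<lparr>carrier := K\<rparr>)"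
  using subfield_iff(2)[OF subfield] .

lemma vectorspace_self: "vectorspace (R\<lparr>carrier := K\<rparr>) (self_module R)"
proof (rule vs_criteria[OF K_field])
  show "\<forall>v\<in>carrier (self_module R). \<exists>n\<in>carrier (self_module R). v \<oplus>\<^bsub>self_module R\<^esub> n = \<zero>\<^bsub>self_module R\<^esub>"
    using r_neg by (auto simp: module_via_def intro!: bexI[of _ "\<ominus> x" for x])
qed (use K_subset in \<open>auto simp: module_via_def a_ac m_assoc l_distr r_distr subset_iff\<close>)

lemma K_subspaceD:
  assumes "K_subspace U"
  shows "U \<subseteq> carrier R" "\<zero> \<in> U" "\<And>x y. \<lbrakk>x \<in> U; y \<in> U\<rbrakk> \<Longrightarrow> x \<oplus> y \<in> U"
    "\<And>c x. \<lbrakk>c \<in> K; x \<in> U\<rbrakk> \<Longrightarrow> c \<otimes> x \<in> U" "\<And>x. x \<in> U \<Longrightarrow> \<ominus> x \<in> U"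
    "\<And>x y. \<lbrakk>x \<in> U; y \<in> U\<rbrakk> \<Longrightarrow> x \<ominus> y \<in> U"
proof -
  show U: "U \<subseteq> carrier R" "\<zero> \<in> U" "\<And>x y. \<lbrakk>x \<in> U; y \<in> U\<rbrakk> \<Longrightarrow> x \<oplus> y \<in> U"
    "\<And>c x. \<lbrakk>c \<in> K; x \<in> U\<rbrakk> \<Longrightarrow> c \<otimes> x \<in> U"
    using assms unfolding K_subspace_def by blast+
  show neg: "\<ominus> x \<in> U" if "x \<in> U" for x
  proof -
    have "\<ominus> x = (\<ominus> \<one>) \<otimes> x" using that U(1) by (simp add: l_minus subset_iff)
    then show ?thesis using U(4)[OF neg_K[OF one_K] that] by simp
  qed
  show "x \<ominus> y \<in> U" if "x \<in> U" "y \<in> U" for x y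
    using U(3)[OF that(1) neg[OF that(2)]] by (simp add: a_minus_def)
qed

lemma subspace_iff: "subspace (R\<lparr>carrier := K\<rparr>) U (self_module R) \<longleftrightarrow> K_subspace U"
proof
  assume "subspace (R\<lparr>carrier := K\<rparr>) U (self_module R)"
  from vectorspace.subspaceD[OF vectorspace_self this]
  show "K_subspace U" by (simp add: K_subspace_def module_via_def)
next
  assume "K_subspace U"
  then show "subspace (R\<lparr>carrier := K\<rparr>) U (self_module R)"
    by (intro vectorspace.subspaceI[OF vectorspace_self]) (simp_all add: K_subspace_def module_via_def)
qed

lemma fin_dim_K_subspace: "fin_dim_subspace U \<Longrightarrow> K_subspace U"
  unfolding fin_dim_subspace_def vectorspace.fin_subspace_def[OF vectorspace_self] subspace_iff by blast

lemma zero_self [simp]: "\<zero>\<^bsub>self_module R\<^esub> = \<zero>"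
  by (simp add: module_via_def)

lemma kdim_zero: "fin_dim_subspace {\<zero>}" "kdim {\<zero>} = 0"
  using vectorspace.sdim_zero[OF vectorspace_self] by (simp_all add: fin_dim_subspace_def kdim_def)

lemma kdim_mono:
  assumes "fin_dim_subspace U" "W \<subseteq> U" "K_subspace W"
  shows "fin_dim_subspace W" "kdim W \<le> kdim U"
  using vectorspace.fin_subspace_subset[OF vectorspace_self, folded fin_dim_subspace_def subspace_iff, OF assms(1,2)]
    assms(3) subspace_iff by (simp_all add: kdim_def)

lemma kdim_psubset:
  assumes "fin_dim_subspace U" "W \<subset> U" "K_subspace W"
  shows "kdim W < kdim U"
  using vectorspace.sdim_psubset[OF vectorspace_self, folded fin_dim_subspace_def, OF assms(1,2)]
    assms(3) subspace_iff by (simp add: kdim_def)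

lemma K_subspace_Int: "\<lbrakk>K_subspace U; K_subspace W\<rbrakk> \<Longrightarrow> K_subspace (U \<inter> W)"
  unfolding K_subspace_def by blast

lemma K_subspace_ideal:
  assumes "ideal I R"
  shows "K_subspace I"
proof -
  interpret ideal I R by fact
  show ?thesis unfolding K_subspace_def
    using a_subset I_l_closed K_subset additive_subgroup.a_closed[OF additive_subgroup_axioms] zero_closed by blast
qed

lemma mult_hom: "u \<in> carrier R \<Longrightarrow>
    (\<lambda>y. u \<otimes> y) \<in> module_hom (R\<lparr>carrier := K\<rparr>) (self_module R) (self_module R)"
  using K_subset by (auto simp: module_hom_def module_via_def r_distr m_lcomm subset_iff)

text \<open>The source of all dimension counts below: \<open>B = {\<zero>}\<close> gives
  rank-nullity for multiplication by \<open>u\<close>, and \<open>u = \<one>\<close> gives the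
  dimension formula for a sum of subspaces.\<close>

lemma kdim_mult_sum:
  assumes "u \<in> carrier R" "fin_dim_subspace U" "fin_dim_subspace B"
  shows "fin_dim_subspace {u \<otimes> y \<oplus> b |y b. y \<in> U \<and> b \<in> B}"
    "kdim {u \<otimes> y \<oplus> b |y b. y \<in> U \<and> b \<in> B} + kdim {y \<in> U. u \<otimes> y \<in> B} = kdim U + kdim B"
proof -
  have *: "x \<oplus>\<^bsub>self_module R\<^esub> y = x \<oplus> y" for x y by (simp add: module_via_def)
  show "fin_dim_subspace {u \<otimes> y \<oplus> b |y b. y \<in> U \<and> b \<in> B}"
    "kdim {u \<otimes> y \<oplus> b |y b. y \<in> U \<and> b \<in> B} + kdim {y \<in> U. u \<otimes> y \<in> B} = kdim U + kdim B"
    using vectorspace.sdim_image_sum[OF vectorspace_self mult_hom, of u U B] assms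
    unfolding * fin_dim_subspace_def kdim_def by blast+
qed

lemma kdim_mult:
  assumes "u \<in> carrier R" "fin_dim_subspace U"
  shows "fin_dim_subspace ((\<otimes>) u ` U)" "kdim ((\<otimes>) u ` U) + kdim {y \<in> U. u \<otimes> y = \<zero>} = kdim U"
proof -
  have "{u \<otimes> y \<oplus> b |y b. y \<in> U \<and> b \<in> {\<zero>}} = (\<otimes>) u ` U"
    using assms(1) K_subspaceD(1)[OF fin_dim_K_subspace[OF assms(2)]] by (force simp: subset_iff)
  then show "fin_dim_subspace ((\<otimes>) u ` U)" "kdim ((\<otimes>) u ` U) + kdim {y \<in> U. u \<otimes> y = \<zero>} = kdim U"
    using kdim_mult_sum[OF assms kdim_zero(1)] by (simp_all add: kdim_zero)
qed

lemma kdim_sum: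
  assumes "fin_dim_subspace U" "fin_dim_subspace B"
  shows "fin_dim_subspace {y \<oplus> b |y b. y \<in> U \<and> b \<in> B}"
    "kdim {y \<oplus> b |y b. y \<in> U \<and> b \<in> B} + kdim (U \<inter> B) = kdim U + kdim B"
proof -
  note Uc = K_subspaceD(1)[OF fin_dim_K_subspace[OF assms(1)]]
  have 1: "{\<one> \<otimes> y \<oplus> b |y b. y \<in> U \<and> b \<in> B} = {y \<oplus> b |y b. y \<in> U \<and> b \<in> B}"
    using Uc by (force simp: subset_iff)
  have 2: "{y \<in> U. \<one> \<otimes> y \<in> B} = U \<inter> B" using Uc by auto
  show "fin_dim_subspace {y \<oplus> b |y b. y \<in> U \<and> b \<in> B}"
    "kdim {y \<oplus> b |y b. y \<in> U \<and> b \<in> B} + kdim (U \<inter> B) = kdim U + kdim B"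
    using kdim_mult_sum[OF one_closed assms] unfolding 1 2 by blast+
qed

lemma kdim_ge_card:
  assumes "fin_dim_subspace U" "F \<subseteq> U" "\<not> module.lin_dep (R\<lparr>carrier := K\<rparr>) (self_module R) F"
  shows "card F \<le> kdim U"
  using vectorspace.indep_card_le_sdim(2)[OF vectorspace_self] assms
  by (simp add: fin_dim_subspace_def kdim_def)

lemma exists_indep_subset:
  assumes "fin_dim_subspace U" "l \<le> kdim U"
  obtains F where "F \<subseteq> U" "finite F" "card F = l"
    "\<not> module.lin_dep (R\<lparr>carrier := K\<rparr>) (self_module R) F"
  using vectorspace.exists_indep_subset[OF vectorspace_self, of U l] assms
  unfolding fin_dim_subspace_def kdim_def by blast

definition span :: "'a set \<Rightarrow> 'a set"
  where "span = module.span (R\<lparr>carrier := K\<rparr>) (self_module R)"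

lemma module_self: "module (R\<lparr>carrier := K\<rparr>) (self_module R)"
  using vectorspace_self by (simp add: vectorspace_def)

lemma span_fin_dim:
  assumes "finite A" "A \<subseteq> carrier R"
  shows "fin_dim_subspace (span A)"
  using vectorspace.fin_subspace_span[OF vectorspace_self assms(1)] assms(2)
  by (simp add: fin_dim_subspace_def span_def module_via_def)

lemma span_incl: "A \<subseteq> carrier R \<Longrightarrow> A \<subseteq> span A"
  using module.in_own_span[OF module_self, of A] by (simp add: span_def module_via_def)

lemma span_least: "\<lbrakk>A \<subseteq> W; K_subspace W\<rbrakk> \<Longrightarrow> span A \<subseteq> W"
  using module.span_is_subset[OF module_self, of A W] subspace_iff[of W]
  by (simp add: span_def subspace_def)

text \<open>The kernel of \<open>U\<close> mapping to \<open>R/I\<close> is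
  \<open>U \<inter> I\<close>. This allows Hilbert functions of quotients to be computed with
  subspaces of \<open>R\<close> alone.\<close>

lemma kdim_quotient:
  assumes I: "ideal I R" and U: "fin_dim_subspace U"
  shows "vectorspace.dim (R\<lparr>carrier := K\<rparr>) (quot_module R I\<lparr>carrier := a_r_coset R I ` U\<rparr>)
    + kdim (U \<inter> I) = kdim U"
proof -
  interpret I: ideal I R by fact
  interpret Q: cring "R Quot I" by (rule I.quotient_is_cring) unfold_locales
  have hom: "(+>) I \<in> ring_hom R (R Quot I)" by (rule I.rcos_ring_hom)
  note hs = ring_hom_closed[OF hom] ring_hom_mult[OF hom] ring_hom_add[OF hom] ring_hom_one[OF hom]
  have zero: "\<zero>\<^bsub>R Quot I\<^esub> = I" by (simp add: FactRing_def)
  have "vectorspace (R\<lparr>carrier := K\<rparr>) (quot_module R I)"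
  proof (rule vs_criteria[OF K_field])
    show "\<forall>v\<in>carrier (quot_module R I). \<exists>n\<in>carrier (quot_module R I). v \<oplus>\<^bsub>quot_module R I\<^esub> n = \<zero>\<^bsub>quot_module R I\<^esub>"
      using Q.r_neg by (auto simp: module_via_def intro!: bexI[of _ "\<ominus>\<^bsub>R Quot I\<^esub> x" for x])
  qed (use K_subset in \<open>auto simp: module_via_def Q.a_ac Q.m_assoc Q.l_distr Q.r_distr hs subset_iff\<close>)
  moreover have "(+>) I \<in> module_hom (R\<lparr>carrier := K\<rparr>) (self_module R) (quot_module R I)"
    using K_subset by (auto simp: module_hom_def module_via_def hs subset_iff)
  moreover have "{y \<in> U. I +> y = \<zero>\<^bsub>quot_module R I\<^esub>} = U \<inter> I"
    using K_subspaceD(1)[OF fin_dim_K_subspace[OF U]] I.a_rcos_const I.a_rcos_self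
    by (auto simp: module_via_def zero)
  ultimately show ?thesis
    using vectorspace.rank_nullity_on(2)[OF vectorspace_self, of "quot_module R I" "(+>) I" U] U
    by (simp add: kdim_def fin_dim_subspace_def)
qed

end

section \<open>The grading and the filtration by degree\<close>

text \<open>Zorn's lemma for inclusion: in a Noetherian ring the union of a nonempty chain of ideals
  belongs to the chain, hence to \<open>C\<close>.\<close>

lemma (in noetherian_ring) ideals_have_maximal:
  assumes "C \<noteq> {}" "\<And>I. I \<in> C \<Longrightarrow> ideal I R"
  obtains M where "M \<in> C" "\<And>J. \<lbrakk>J \<in> C; M \<subseteq> J\<rbrakk> \<Longrightarrow> J = M"
proof -
  have "\<exists>M\<in>C. \<forall>X\<in>C. M \<subseteq> X \<longrightarrow> X = M"
  proof (rule subset_Zorn)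
    fix D assume D: "subset.chain C D"
    show "\<exists>U\<in>C. \<forall>X\<in>D. X \<subseteq> U"
    proof (cases "D = {}")
      case True
      then show ?thesis using assms(1) by blast
    next
      case False
      have "subset.chain {I. ideal I R} D"
        using D assms(2) unfolding pred_on.chain_def by blast
      from ideal_chain_is_trivial[OF False this] have "\<Union>D \<in> D" .
      moreover have "D \<subseteq> C" using D unfolding pred_on.chain_def by blast
      ultimately show ?thesis by (meson Union_upper subsetD)
    qed
  qed
  then obtain M where "M \<in> C" "\<forall>X\<in>C. M \<subseteq> X \<longrightarrow> X = M" by blast
  then show ?thesis by (intro that[of M]) simp_all
qed

sublocale standard_graded_algebra \<subseteq> subfield_algebra R K
  by (intro subfield_algebra.intro subfield_algebra_axioms.intro subfield_K is_cring)

context standard_graded_algebra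
begin

text \<open>The sum of the components of degree strictly below \<open>k\<close>. With the strict
  bound, \<open>z \<oplus> w\<close> for \<open>z \<in> G k\<close> and
  \<open>w \<in> lower k\<close> displays \<open>z\<close> as the leading component, and the
  recursion peels it off.\<close>

primrec lower :: "nat \<Rightarrow> 'a set"
  where "lower 0 = {\<zero>}"
  | "lower (Suc k) = {x \<oplus> y |x y. x \<in> lower k \<and> y \<in> G k}"

lemma G_carrier: "G i \<subseteq> carrier R"
  using additive_subgroup.a_subset[OF additive_subgroup_G] .

lemma K_subspace_G: "K_subspace (G i)"
  unfolding K_subspace_def
  using G_carrier additive_subgroup.zero_closed[OF additive_subgroup_G]
    additive_subgroup.a_closed[OF additive_subgroup_G] mult_G[of _ 0 _ i] G_0 by auto

lemma K_subspace_sum: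
  assumes "K_subspace U" "K_subspace W"
  shows "K_subspace {x \<oplus> y |x y. x \<in> U \<and> y \<in> W}"
proof -
  note U = K_subspaceD[OF assms(1)] and W = K_subspaceD[OF assms(2)]
  show ?thesis unfolding K_subspace_def
  proof (intro conjI ballI)
    show "{x \<oplus> y |x y. x \<in> U \<and> y \<in> W} \<subseteq> carrier R" using U(1) W(1) by auto
    show "\<zero> \<in> {x \<oplus> y |x y. x \<in> U \<and> y \<in> W}" using U(2) W(2) by force
    fix p q assume "p \<in> {x \<oplus> y |x y. x \<in> U \<and> y \<in> W}" "q \<in> {x \<oplus> y |x y. x \<in> U \<and> y \<in> W}"
    then obtain x y x' y' where *: "p = x \<oplus> y" "q = x' \<oplus> y'" "x \<in> U" "x' \<in> U" "y \<in> W" "y' \<in> W" by blast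
    moreover have "p \<oplus> q = (x \<oplus> x') \<oplus> (y \<oplus> y')"
      using * U(1) W(1) by (simp add: subset_iff a_ac)
    ultimately show "p \<oplus> q \<in> {x \<oplus> y |x y. x \<in> U \<and> y \<in> W}" using U(3) W(3) by blast
  next
    fix c p assume c: "c \<in> K" and "p \<in> {x \<oplus> y |x y. x \<in> U \<and> y \<in> W}"
    then obtain x y where *: "p = x \<oplus> y" "x \<in> U" "y \<in> W" by blast
    then have "c \<otimes> p = c \<otimes> x \<oplus> c \<otimes> y"
      using c K_subset U(1) W(1) by (simp add: subset_iff r_distr)
    then show "c \<otimes> p \<in> {x \<oplus> y |x y. x \<in> U \<and> y \<in> W}" using * c U(4) W(4) by blast
  qed
qed

lemma K_subspace_lower: "K_subspace (lower k)"
proof (induction k)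
  case 0
  show ?case using K_subset by (auto simp: K_subspace_def)
next
  case (Suc k)
  then show ?case using K_subspace_sum[OF _ K_subspace_G] by simp
qed

lemmas lower_carrier = K_subspaceD(1)[OF K_subspace_lower]

lemma lower_Suc_mono: "lower k \<subseteq> lower (Suc k)"
proof
  fix x assume x: "x \<in> lower k"
  have "x = x \<oplus> \<zero>" using x lower_carrier by (simp add: subset_iff)
  then show "x \<in> lower (Suc k)" using x K_subspaceD(2)[OF K_subspace_G] by auto
qed

lemma lower_mono: "k \<le> l \<Longrightarrow> lower k \<subseteq> lower l"
  using lift_Suc_mono_le[of lower k l] lower_Suc_mono by simp

lemma G_subset_lower: "i < k \<Longrightarrow> G i \<subseteq> lower k"
proof
  fix x assume "i < k" and x: "x \<in> G i"
  have "x = \<zero> \<oplus> x" using x G_carrier by (simp add: subset_iff)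
  then have "x \<in> lower (Suc i)" using x K_subspaceD(2)[OF K_subspace_lower] by auto
  then show "x \<in> lower k" using lower_mono[of "Suc i" k] \<open>i < k\<close> by auto
qed

lemma carrier_in_lower:
  assumes "x \<in> carrier R"
  obtains k where "x \<in> lower k"
proof -
  obtain f where f: "\<And>i. f i \<in> G i" "finite {i. f i \<noteq> \<zero>}" "x = (\<Oplus>i\<in>{i. f i \<noteq> \<zero>}. f i)"
    using decomposition[OF assms] by blast
  obtain k where k: "{i. f i \<noteq> \<zero>} \<subseteq> {..<k}"
    using f(2) finite_nat_iff_bounded by blast
  have "(\<Oplus>i\<in>A. f i) \<in> lower k" if "finite A" "A \<subseteq> {..<k}" for A
    using that
  proof (induction A rule: finite_induct)
    case empty
    then show ?case using K_subspaceD(2)[OF K_subspace_lower] by simp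
  next
    case (insert i A)
    have "(\<Oplus>i\<in>insert i A. f i) = f i \<oplus> (\<Oplus>i\<in>A. f i)"
      using insert.hyps f(1) G_carrier by (intro finsum_insert) auto
    moreover have "f i \<in> lower k" using G_subset_lower[of i k] f(1) insert.prems by blast
    ultimately show ?case using insert K_subspaceD(3)[OF K_subspace_lower] by simp
  qed
  then show ?thesis using that f(2,3) k by blast
qed

lemma lower_decomposition:
  assumes "x \<in> lower k"
  obtains f where "\<And>i. f i \<in> G i" "\<And>i. i \<ge> k \<Longrightarrow> f i = \<zero>" "x = (\<Oplus>i\<in>{..<k}. f i)"
  using assms
proof (induction k arbitrary: x thesis)
  case 0
  show ?case by (rule 0(1)[of "\<lambda>_. \<zero>"]) (use 0(2) K_subspaceD(2)[OF K_subspace_G] in auto)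
next
  case (Suc k)
  obtain x' y where y: "x' \<in> lower k" "y \<in> G k" "x = x' \<oplus> y" using Suc.prems(2) by auto
  obtain f where f: "\<And>i. f i \<in> G i" "\<And>i. i \<ge> k \<Longrightarrow> f i = \<zero>" "x' = (\<Oplus>i\<in>{..<k}. f i)"
    using Suc.IH[OF _ y(1)] by blast
  have c: "f i \<in> carrier R" for i using f(1) G_carrier by blast
  have "(\<Oplus>i\<in>{..<Suc k}. (f(k := y)) i) = y \<oplus> (\<Oplus>i\<in>{..<k}. (f(k := y)) i)"
    unfolding lessThan_Suc using c y(2) G_carrier by (subst finsum_insert) auto
  also have "(\<Oplus>i\<in>{..<k}. (f(k := y)) i) = x'"
    unfolding f(3) by (rule finsum_cong') (auto simp: c)
  also have "y \<oplus> x' = x" using y lower_carrier G_carrier by (simp add: a_comm subset_iff)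
  finally have "x = (\<Oplus>i\<in>{..<Suc k}. (f(k := y)) i)" ..
  then show ?case using Suc.prems(1)[of "f(k := y)"] f(1,2) y(2) by auto
qed

text \<open>Uniqueness of the decomposition: a nonzero \<open>x\<close> would have one decomposition
  with components below \<open>k\<close> only and another concentrated in degree
  \<open>i \<ge> k\<close>.\<close>

lemma lower_Int_G:
  assumes "x \<in> lower k" "x \<in> G i" "k \<le> i"
  shows "x = \<zero>"
proof (rule ccontr)
  assume x: "x \<noteq> \<zero>"
  have xc: "x \<in> carrier R" using assms(2) G_carrier by blast
  obtain f where f: "\<And>i. f i \<in> G i" "\<And>i. i \<ge> k \<Longrightarrow> f i = \<zero>" "x = (\<Oplus>i\<in>{..<k}. f i)"
    using lower_decomposition[OF assms(1)] by blast
  have c: "f i \<in> carrier R" for i using f(1) G_carrier by blast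
  have sub: "{i. f i \<noteq> \<zero>} \<subseteq> {..<k}" using f(2) by (auto simp: not_le[symmetric])
  have "x = (\<Oplus>i\<in>{i. f i \<noteq> \<zero>}. f i)"
    unfolding f(3) by (rule add.finprod_mono_neutral_cong_right) (use sub c in auto)
  then have F: "(\<forall>i. f i \<in> G i) \<and> finite {i. f i \<noteq> \<zero>} \<and> x = (\<Oplus>i\<in>{i. f i \<noteq> \<zero>}. f i)"
    using f(1) sub finite_subset by blast
  define g where "g = (\<lambda>j. if j = i then x else \<zero>)"
  have supp: "{j. g j \<noteq> \<zero>} = {i}" using x by (auto simp: g_def)
  have "(\<Oplus>i\<in>{i}. g i) = x" using xc by (simp add: g_def)
  then have "(\<forall>i. g i \<in> G i) \<and> finite {i. g i \<noteq> \<zero>} \<and> x = (\<Oplus>i\<in>{i. g i \<noteq> \<zero>}. g i)"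
    unfolding supp using assms(2) K_subspaceD(2)[OF K_subspace_G] by (auto simp: g_def)
  with F have "f = g" using decomposition[OF xc] by blast
  then have "g i = \<zero>" using f(2)[OF assms(3)] by simp
  then show False using x by (simp add: g_def)
qed

lemma lower_mult:
  assumes "y \<in> G i"
  shows "x \<in> lower k \<Longrightarrow> x \<otimes> y \<in> lower (k + i)"
proof (induction k arbitrary: x)
  case 0
  then show ?case using assms G_carrier K_subspaceD(2)[OF K_subspace_lower] by (auto simp: subset_iff)
next
  case (Suc k)
  obtain x' z where z: "x' \<in> lower k" "z \<in> G k" "x = x' \<oplus> z" using Suc.prems by auto
  have "x \<otimes> y = x' \<otimes> y \<oplus> z \<otimes> y"
    using z assms lower_carrier G_carrier by (simp add: l_distr subset_iff)
  then show ?case using Suc.IH[OF z(1)] mult_G[OF z(2) assms] by auto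
qed

lemma lower_mult_lower:
  assumes "x \<in> lower a"
  shows "y \<in> lower k \<Longrightarrow> x \<otimes> y \<in> lower (k + a)"
proof (induction k arbitrary: y)
  case 0
  then show ?case using assms lower_carrier K_subspaceD(2)[OF K_subspace_lower] by (auto simp: subset_iff)
next
  case (Suc k)
  obtain y' z where z: "y' \<in> lower k" "z \<in> G k" "y = y' \<oplus> z" using Suc.prems by auto
  have "x \<otimes> y = x \<otimes> y' \<oplus> x \<otimes> z"
    using z assms lower_carrier G_carrier by (simp add: r_distr subset_iff)
  moreover have "x \<otimes> y' \<in> lower (Suc k + a)" using Suc.IH[OF z(1)] lower_mono[of "k + a" "Suc k + a"] by auto
  moreover have "x \<otimes> z \<in> lower (Suc k + a)"
    using lower_mult[OF z(2) assms] lower_mono[of "a + k" "Suc k + a"] by auto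
  ultimately show ?case using K_subspaceD(3)[OF K_subspace_lower] by metis
qed

section \<open>Monomials in linear generators and the finite dimension of the components\<close>

definition generators :: "'a set"
  where "generators = (SOME S. finite S \<and> S \<subseteq> G 1 \<and> generate_ring R (K \<union> S) = carrier R)"

lemma generators: "finite generators" "generators \<subseteq> G 1" "generate_ring R (K \<union> generators) = carrier R"
  using someI_ex[OF generated] unfolding generators_def by blast+

primrec monomials :: "nat \<Rightarrow> 'a set"
  where "monomials 0 = {\<one>}"
  | "monomials (Suc i) = (\<lambda>(s, m). s \<otimes> m) ` (generators \<times> monomials i)"

lemma monomials_finite: "finite (monomials i)"
  by (induction i) (use generators(1) in auto)

lemma monomials_G: "monomials i \<subseteq> G i"
proof (induction i)
  case 0
  then show ?case using G_0 one_K by simp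
next
  case (Suc i)
  then show ?case using generators(2) mult_G[of _ 1 _ i] by auto
qed

text \<open>The counterpart of \<open>lower\<close> with \<open>G k\<close> replaced by the part
  known to be spanned by monomials. Once it is seen to exhaust \<open>R\<close>, the two gradings
  must agree.\<close>

primrec lower_span :: "nat \<Rightarrow> 'a set"
  where "lower_span 0 = {\<zero>}"
  | "lower_span (Suc k) = {x \<oplus> y |x y. x \<in> lower_span k \<and> y \<in> span (monomials k)}"

lemma span_monomials_subset: "span (monomials i) \<subseteq> G i"
  by (rule span_least[OF monomials_G K_subspace_G])

lemma span_monomials_fin_dim: "fin_dim_subspace (span (monomials i))"
  using span_fin_dim[OF monomials_finite] monomials_G G_carrier by blast

lemma K_subspace_lower_span: "K_subspace (lower_span k)"
proof (induction k)
  case 0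
  show ?case using K_subset by (auto simp: K_subspace_def)
next
  case (Suc k)
  then show ?case using K_subspace_sum[OF _ fin_dim_K_subspace[OF span_monomials_fin_dim]] by simp
qed

lemma lower_span_subset: "lower_span k \<subseteq> lower k"
proof (induction k)
  case (Suc k)
  then show ?case using span_monomials_subset[of k] by auto
qed simp

lemma lower_span_Suc_mono: "lower_span k \<subseteq> lower_span (Suc k)"
proof
  fix x assume x: "x \<in> lower_span k"
  have "x = x \<oplus> \<zero>" using x K_subspaceD(1)[OF K_subspace_lower_span] by (simp add: subset_iff)
  then show "x \<in> lower_span (Suc k)"
    using x K_subspaceD(2)[OF fin_dim_K_subspace[OF span_monomials_fin_dim]] by auto
qed

lemma lower_span_mono: "k \<le> l \<Longrightarrow> lower_span k \<subseteq> lower_span l"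
  using lift_Suc_mono_le[of lower_span k l] lower_span_Suc_mono by simp

lemma generator_mult_span:
  assumes s: "s \<in> generators"
  shows "y \<in> span (monomials i) \<Longrightarrow> s \<otimes> y \<in> span (monomials (Suc i))"
proof -
  \<comment> \<open>The elements that \<open>s\<close> carries into the target form a subspace, so
    it suffices that this subspace contains the monomials.\<close>
  let ?W = "{y \<in> carrier R. s \<otimes> y \<in> span (monomials (Suc i))}"
  have sc: "s \<in> carrier R" using s generators(2) G_carrier by blast
  note sp = K_subspaceD[OF fin_dim_K_subspace[OF span_monomials_fin_dim[of "Suc i"]]]
  have "K_subspace ?W" unfolding K_subspace_def
    using sc sp(2-4) K_subset by (auto simp: r_distr m_lcomm subset_iff)
  moreover have "monomials i \<subseteq> ?W"
  proof
    fix m assume m: "m \<in> monomials i"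
    then have "s \<otimes> m \<in> monomials (Suc i)" using s by auto
    then have "s \<otimes> m \<in> span (monomials (Suc i))"
      using span_incl[OF order_trans[OF monomials_G G_carrier]] by blast
    moreover have "m \<in> carrier R" using m monomials_G G_carrier by blast
    ultimately show "m \<in> ?W" by simp
  qed
  ultimately have "span (monomials i) \<subseteq> ?W" by (intro span_least)
  then show "y \<in> span (monomials i) \<Longrightarrow> s \<otimes> y \<in> span (monomials (Suc i))" by blast
qed

lemma generator_mult_lower_span:
  assumes s: "s \<in> generators"
  shows "y \<in> lower_span k \<Longrightarrow> s \<otimes> y \<in> lower_span (Suc k)"
proof (induction k arbitrary: y)
  have sc: "s \<in> carrier R" using s generators(2) G_carrier by blast
  {
    case 0
    then show ?case using sc K_subspaceD(2)[OF K_subspace_lower_span, of "Suc 0"] by simp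
  next
    case (Suc k)
    obtain y' z where z: "y' \<in> lower_span k" "z \<in> span (monomials k)" "y = y' \<oplus> z"
      using Suc.prems by auto
    have "s \<otimes> y = s \<otimes> y' \<oplus> s \<otimes> z"
      using z sc K_subspaceD(1)[OF K_subspace_lower_span] K_subspaceD(1)[OF fin_dim_K_subspace[OF span_monomials_fin_dim]]
      by (simp add: r_distr subset_iff)
    then show ?case using Suc.IH[OF z(1)] generator_mult_span[OF s z(2)] by auto
  }
qed

text \<open>The multipliers of the union of the spans of the monomials form a subring containing the
  generators, hence are everything; as \<open>\<one>\<close> lies in that union, so does every element.\<close>

lemma carrier_in_lower_span:
  assumes "x \<in> carrier R"
  obtains k where "x \<in> lower_span k"
proof -
  define E where "E = (\<Union>k. lower_span k)"
  have Ec: "E \<subseteq> carrier R" using K_subspaceD(1)[OF K_subspace_lower_span] by (auto simp: E_def)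
  have Eadd: "a \<oplus> b \<in> E" if "a \<in> E" "b \<in> E" for a b
  proof -
    obtain k l where "a \<in> lower_span k" "b \<in> lower_span l" using \<open>a \<in> E\<close> \<open>b \<in> E\<close> by (auto simp: E_def)
    then have "a \<in> lower_span (max k l)" "b \<in> lower_span (max k l)"
      using lower_span_mono[of k "max k l"] lower_span_mono[of l "max k l"] by auto
    then show ?thesis using K_subspaceD(3)[OF K_subspace_lower_span] unfolding E_def by blast
  qed
  have Eneg: "\<ominus> a \<in> E" if "a \<in> E" for a
    using that K_subspaceD(5)[OF K_subspace_lower_span] unfolding E_def by blast
  have EK: "c \<otimes> a \<in> E" if "c \<in> K" "a \<in> E" for a c
    using that K_subspaceD(4)[OF K_subspace_lower_span] unfolding E_def by blast
  have ES: "s \<otimes> a \<in> E" if "s \<in> generators" "a \<in> E" for a s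
    using that generator_mult_lower_span unfolding E_def by blast
  define M where "M = {a \<in> carrier R. \<forall>b\<in>E. a \<otimes> b \<in> E}"
  have "subring M R"
  proof (rule subringI)
    fix a b assume a: "a \<in> M" and b: "b \<in> M"
    have "(a \<otimes> b) \<otimes> c = a \<otimes> (b \<otimes> c)" "(a \<oplus> b) \<otimes> c = a \<otimes> c \<oplus> b \<otimes> c" if "c \<in> E" for c
      using a b that Ec by (auto simp: M_def m_assoc l_distr subset_iff)
    then show "a \<otimes> b \<in> M" "a \<oplus> b \<in> M" using a b Eadd by (simp_all add: M_def)
  next
    fix a assume a: "a \<in> M"
    have "(\<ominus> a) \<otimes> c = \<ominus> (a \<otimes> c)" if "c \<in> E" for c
      using a that Ec by (auto simp: M_def l_minus subset_iff)
    then show "\<ominus> a \<in> M" using a Eneg by (simp add: M_def)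
  qed (use Ec in \<open>auto simp: M_def subset_iff\<close>)
  moreover have "K \<union> generators \<subseteq> M"
    using K_subset generators(2) G_carrier EK ES unfolding M_def by blast
  ultimately have "carrier R \<subseteq> M"
    using generate_ring_min_subring1[of "K \<union> generators" M] generators K_subset G_carrier by blast
  moreover have "\<one> \<in> E"
  proof -
    have "\<one> \<in> span (monomials 0)" using span_incl[of "monomials 0"] by simp
    then have "\<one> \<in> lower_span (Suc 0)" by force
    then show ?thesis unfolding E_def by blast
  qed
  ultimately have "x \<otimes> \<one> \<in> E" using assms unfolding M_def by blast
  then have "x \<in> E" using assms by simp
  then show ?thesis using that unfolding E_def by blast
qed

text \<open>An element \<open>x\<close> of \<open>G i\<close> lies in some
  \<open>lower_span k\<close>. Comparing top components by \<open>lower_Int_G\<close>, a top part of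
  degree above \<open>i\<close> vanishes, one of degree \<open>i\<close> is all of \<open>x\<close>,
  and if all degrees are below \<open>i\<close> then \<open>x\<close> itself is zero.\<close>

lemma G_eq_span_monomials: "G i = span (monomials i)"
proof (intro equalityI span_monomials_subset subsetI)
  fix x assume x: "x \<in> G i"
  note sp = K_subspaceD[OF fin_dim_K_subspace[OF span_monomials_fin_dim]]
  note ls = K_subspaceD[OF K_subspace_lower_span]
  have "x \<in> span (monomials i)" if "x \<in> lower_span k" for k
    using that
  proof (induction k)
    case 0
    then show ?case using sp(2) by simp
  next
    case (Suc k)
    obtain y h where y: "y \<in> lower_span k" "h \<in> span (monomials k)" "x = y \<oplus> h" using Suc.prems by auto
    have hG: "h \<in> G k" and yl: "y \<in> lower k" using y span_monomials_subset lower_span_subset by blast+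
    have c: "y \<in> carrier R" "h \<in> carrier R" "x \<in> carrier R"
      using hG yl x G_carrier lower_carrier by blast+
    consider "k = i" | "i < k" | "k < i" by linarith
    then show ?case
    proof cases
      case 1
      have "x \<ominus> h = y" using c y(3) by (simp add: a_minus_def a_assoc r_neg)
      then have "y \<in> G i" using K_subspaceD(6)[OF K_subspace_G x, of h] hG 1 by simp
      then have "y = \<zero>" using lower_Int_G[OF yl] 1 by simp
      then show ?thesis using y(2,3) 1 c by simp
    next
      case 2
      have "x \<ominus> y = h" using c y(3) by (simp add: a_minus_def a_comm[of y h] a_assoc r_neg)
      moreover have "x \<in> lower k" using G_subset_lower[OF 2] x by blast
      ultimately have "h \<in> lower k" using K_subspaceD(6)[OF K_subspace_lower _ yl] by metis
      then have "h = \<zero>" using lower_Int_G[OF _ hG] by simp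
      then show ?thesis using Suc.IH y c by simp
    next
      case 3
      then have "x \<in> lower i" using Suc.prems lower_span_subset[of "Suc k"] lower_mono[of "Suc k" i] by auto
      then show ?thesis using lower_Int_G[OF _ x] sp(2) by blast
    qed
  qed
  then show "x \<in> span (monomials i)"
    using carrier_in_lower_span[of x] x G_carrier by blast
qed

lemma G_fin_dim: "fin_dim_subspace (G i)"
  using span_monomials_fin_dim[of i] unfolding G_eq_span_monomials[symmetric] .

text \<open>This is where generation in degree one counts: an ideal missing some element of positive
  degree also misses a linear form.\<close>

lemma G_subset_ideal:
  assumes "ideal I R" "G 1 \<subseteq> I" "i \<ge> 1"
  shows "G i \<subseteq> I"
proof -
  interpret ideal I R by fact
  obtain j where j: "i = Suc j" using assms(3) by (cases i) auto
  have "monomials (Suc j) \<subseteq> I"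
  proof
    fix x assume "x \<in> monomials (Suc j)"
    then obtain s m where "s \<in> generators" "m \<in> monomials j" "x = s \<otimes> m" by auto
    then show "x \<in> I"
      using generators(2) assms(2) monomials_G G_carrier I_r_closed by blast
  qed
  from span_least[OF this K_subspace_ideal[OF assms(1)]] show ?thesis
    unfolding G_eq_span_monomials[symmetric] j .
qed

lemma lower_fin_dim: "fin_dim_subspace (lower k)"
  by (induction k) (use kdim_zero(1) kdim_sum(1)[OF _ G_fin_dim] in auto)

lemma kdim_lower_le: "kdim (lower (Suc k)) \<le> (\<Sum>i\<le>k. kdim (G i))"
proof (induction k)
  case 0
  show ?case using kdim_sum(2)[OF kdim_zero(1) G_fin_dim, of 0] by (simp add: kdim_zero)
next
  case (Suc k)
  then show ?case using kdim_sum(2)[OF lower_fin_dim G_fin_dim, of "Suc k" "Suc k"] by simp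
qed

section \<open>Homogeneous ideals\<close>

text \<open>Homogeneity of an ideal is only needed, and hence stated, for leading components.\<close>

definition homogeneous_ideal :: "'a set \<Rightarrow> bool"
  where "homogeneous_ideal I \<longleftrightarrow> ideal I R \<and>
    (\<forall>k. \<forall>z\<in>G k. \<forall>w\<in>lower k. z \<oplus> w \<in> I \<longrightarrow> z \<in> I)"

definition adjoin :: "'a set \<Rightarrow> 'a \<Rightarrow> 'a set"
  where "adjoin I x = {x \<otimes> r \<oplus> b |r b. r \<in> carrier R \<and> b \<in> I}"

text \<open>The ideal quotient \<open>I : x\<close>. In particular \<open>colon {\<zero>} u\<close>
  is the annihilator of \<open>u\<close>.\<close>

definition colon :: "'a set \<Rightarrow> 'a \<Rightarrow> 'a set"
  where "colon I x = {r \<in> carrier R. x \<otimes> r \<in> I}"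

text \<open>The Hilbert function of \<open>R/I\<close>, expressed inside \<open>R\<close> by means
  of \<open>kdim_quotient\<close>; real values avoid truncated subtraction.\<close>

definition hilb :: "'a set \<Rightarrow> nat \<Rightarrow> real"
  where "hilb I i = real (kdim (G i)) - real (kdim (G i \<inter> I))"

definition hilb_sum :: "'a set \<Rightarrow> nat \<Rightarrow> real"
  where "hilb_sum I t = (\<Sum>i\<le>t. hilb I i)"

lemma idealD:
  assumes "ideal I R"
  shows "I \<subseteq> carrier R" "\<zero> \<in> I" "\<And>x y. \<lbrakk>x \<in> I; y \<in> I\<rbrakk> \<Longrightarrow> x \<oplus> y \<in> I"
    "\<And>x. x \<in> I \<Longrightarrow> \<ominus> x \<in> I" "\<And>x r. \<lbrakk>x \<in> I; r \<in> carrier R\<rbrakk> \<Longrightarrow> r \<otimes> x \<in> I"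
  by (fact K_subspaceD(1-3,5)[OF K_subspace_ideal[OF assms]] ideal.I_l_closed[OF assms])+

lemma ideal_criterion:
  assumes "I \<subseteq> carrier R" "\<zero> \<in> I" "\<And>x y. \<lbrakk>x \<in> I; y \<in> I\<rbrakk> \<Longrightarrow> x \<oplus> y \<in> I"
    "\<And>x r. \<lbrakk>x \<in> I; r \<in> carrier R\<rbrakk> \<Longrightarrow> r \<otimes> x \<in> I"
  shows "ideal I R"
proof (rule idealI[OF ring_axioms])
  show "subgroup I (add_monoid R)"
  proof (rule add.subgroupI)
    fix a assume "a \<in> I"
    then have "(\<ominus> \<one>) \<otimes> a \<in> I" "a \<in> carrier R" using assms(1,4) by auto
    then show "\<ominus> a \<in> I" by (simp add: l_minus)
  qed (use assms in auto)
  show "x \<otimes> a \<in> I" "a \<otimes> x \<in> I" if "a \<in> I" "x \<in> carrier R" for a x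
    using assms(1) assms(4)[OF that] that m_comm[of a x] by auto
qed

lemma homogeneous_ideal_ideal: "homogeneous_ideal I \<Longrightarrow> ideal I R"
  by (simp add: homogeneous_ideal_def)

lemma homogeneous_idealD:
  "\<lbrakk>homogeneous_ideal I; z \<in> G k; w \<in> lower k; z \<oplus> w \<in> I\<rbrakk> \<Longrightarrow> z \<in> I"
  unfolding homogeneous_ideal_def by blast

lemma homogeneous_zero: "homogeneous_ideal {\<zero>}"
  unfolding homogeneous_ideal_def
proof (intro conjI allI ballI impI)
  show "ideal {\<zero>} R" by (rule zeroideal)
  fix k z w assume z: "z \<in> G k" and w: "w \<in> lower k" and "z \<oplus> w \<in> {\<zero>}"
  then have zw: "z \<oplus> w = \<zero>" by simp
  have "z \<in> carrier R" "w \<in> carrier R" using z w G_carrier lower_carrier by blast+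
  then have "z = \<ominus> w" using minus_equality[OF zw] by simp
  then have "z \<in> lower k" using K_subspaceD(5)[OF K_subspace_lower w] by simp
  then show "z \<in> {\<zero>}" using lower_Int_G[OF _ z] by simp
qed

lemma ideal_adjoin:
  assumes "ideal I R" "x \<in> carrier R"
  shows "ideal (adjoin I x) R"
proof (rule ideal_criterion)
  note I = idealD[OF assms(1)]
  show "adjoin I x \<subseteq> carrier R" using I(1) assms(2) by (auto simp: adjoin_def)
  have "x \<otimes> \<zero> \<oplus> \<zero> = \<zero>" using assms(2) by simp
  then show "\<zero> \<in> adjoin I x" unfolding adjoin_def using I(2) zero_closed by force
  fix p assume "p \<in> adjoin I x"
  then obtain r b where p: "p = x \<otimes> r \<oplus> b" "r \<in> carrier R" "b \<in> I" by (auto simp: adjoin_def)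
  have b: "b \<in> carrier R" using p I(1) by blast
  { fix q assume "q \<in> adjoin I x"
    then obtain s c where q: "q = x \<otimes> s \<oplus> c" "s \<in> carrier R" "c \<in> I" by (auto simp: adjoin_def)
    have "c \<in> carrier R" using q I(1) by blast
    then have "p \<oplus> q = x \<otimes> (r \<oplus> s) \<oplus> (b \<oplus> c)"
      using p q b assms(2) by (simp add: r_distr a_ac)
    then show "p \<oplus> q \<in> adjoin I x" unfolding adjoin_def using p q I(3) by blast }
  fix s assume s: "s \<in> carrier R"
  have "s \<otimes> p = x \<otimes> (s \<otimes> r) \<oplus> s \<otimes> b"
    using p b s assms(2) by (simp add: r_distr m_lcomm)
  then show "s \<otimes> p \<in> adjoin I x" unfolding adjoin_def using p s I(5) by blast
qed

lemma adjoin_incl: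
  assumes "ideal I R" "x \<in> carrier R"
  shows "I \<subseteq> adjoin I x" "x \<in> adjoin I x"
proof -
  note I = idealD[OF assms(1)]
  show "I \<subseteq> adjoin I x"
  proof
    fix b assume b: "b \<in> I"
    then have "b = x \<otimes> \<zero> \<oplus> b" using I(1) assms(2) by auto
    then show "b \<in> adjoin I x" unfolding adjoin_def using b zero_closed by blast
  qed
  have "x = x \<otimes> \<one> \<oplus> \<zero>" using assms(2) by simp
  then show "x \<in> adjoin I x" unfolding adjoin_def using I(2) one_closed by blast
qed

lemma adjoin_least:
  assumes "ideal J R" "I \<subseteq> J" "x \<in> J"
  shows "adjoin I x \<subseteq> J"
proof
  note J = idealD[OF assms(1)]
  fix p assume "p \<in> adjoin I x"
  then obtain r b where p: "p = x \<otimes> r \<oplus> b" "r \<in> carrier R" "b \<in> I" by (auto simp: adjoin_def)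
  have "x \<otimes> r \<in> J" using J(5)[OF assms(3) p(2)] J(1) assms(3) p(2) m_comm[of x r] by auto
  then show "p \<in> J" using J(3) p(1,3) assms(2) by blast
qed

lemma ideal_colon:
  assumes "ideal I R" "x \<in> carrier R"
  shows "ideal (colon I x) R"
proof (rule ideal_criterion)
  note I = idealD[OF assms(1)]
  show "colon I x \<subseteq> carrier R" "\<zero> \<in> colon I x" using assms(2) I(2) by (auto simp: colon_def)
  show "r \<oplus> s \<in> colon I x" if "r \<in> colon I x" "s \<in> colon I x" for r s
    using that assms(2) I(3) by (simp add: colon_def r_distr)
  show "s \<otimes> r \<in> colon I x" if "r \<in> colon I x" "s \<in> carrier R" for r s
    using that assms(2) I(5) by (simp add: colon_def m_lcomm[of x s r])
qed

lemma colon_incl: "\<lbrakk>ideal I R; x \<in> carrier R\<rbrakk> \<Longrightarrow> I \<subseteq> colon I x"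
  unfolding colon_def using idealD[of I] by blast

lemma homogeneous_colon:
  assumes "homogeneous_ideal I" "x \<in> G a"
  shows "homogeneous_ideal (colon I x)"
  unfolding homogeneous_ideal_def
proof (intro conjI allI ballI impI)
  have x: "x \<in> carrier R" using assms(2) G_carrier by blast
  show "ideal (colon I x) R" using ideal_colon[OF homogeneous_ideal_ideal[OF assms(1)] x] .
  fix k z w assume z: "z \<in> G k" and w: "w \<in> lower k" and zw: "z \<oplus> w \<in> colon I x"
  have c: "z \<in> carrier R" "w \<in> carrier R" using z w G_carrier lower_carrier by blast+
  have "x \<otimes> z \<oplus> w \<otimes> x \<in> I" using zw c x by (simp add: colon_def r_distr m_comm)
  moreover have "x \<otimes> z \<in> G (k + a)" using mult_G[OF assms(2) z] by (simp add: add.commute)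
  ultimately have "x \<otimes> z \<in> I" using homogeneous_idealD[OF assms(1)] lower_mult[OF assms(2) w] by blast
  then show "z \<in> colon I x" using c by (simp add: colon_def)
qed

text \<open>Induction on the degree bound of the multiplier \<open>r\<close>, whose top component
  \<open>s\<close> has degree \<open>m\<close>. If \<open>m + a < k\<close>, the term
  \<open>x \<otimes> s\<close> is moved into \<open>w\<close>. If \<open>m + a = k\<close>,
  comparing leading components gives \<open>z \<ominus> x \<otimes> s \<in> I\<close>. If
  \<open>m + a > k\<close>, then \<open>x \<otimes> s\<close> is the leading component of an element
  of \<open>I\<close>, hence in \<open>I\<close>, and is absorbed by \<open>b\<close>.\<close>

lemma adjoin_leading:
  assumes I: "homogeneous_ideal I" and x: "x \<in> G a" and z: "z \<in> G k"
  shows "\<lbrakk>r \<in> lower m; b \<in> I; w \<in> lower k; z \<oplus> w = x \<otimes> r \<oplus> b\<rbrakk>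
    \<Longrightarrow> z \<in> I \<or> a \<le> k \<and> (\<exists>s\<in>G (k - a). z \<ominus> x \<otimes> s \<in> I)"
proof (induction m arbitrary: r b w)
  note Id = idealD[OF homogeneous_ideal_ideal[OF I]]
  have xc: "x \<in> carrier R" and zc: "z \<in> carrier R" using x z G_carrier by blast+
  {
    case 0
    then have "z \<oplus> w \<in> I" using xc Id(1) by auto
    then show ?case using homogeneous_idealD[OF I z] 0 by blast
  next
    case (Suc m)
    obtain r' s where r: "r' \<in> lower m" "s \<in> G m" "r = r' \<oplus> s" using Suc.prems(1) by auto
    have c: "r' \<in> carrier R" "s \<in> carrier R" "b \<in> carrier R" "w \<in> carrier R"
      using r Suc.prems(2,3) Id(1) G_carrier lower_carrier by blast+
    have eq: "z \<oplus> w = x \<otimes> r' \<oplus> x \<otimes> s \<oplus> b"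
      using Suc.prems(4) r(3) c xc by (simp add: r_distr)
    have xs: "x \<otimes> s \<in> G (m + a)" using mult_G[OF x r(2)] by (simp add: add.commute)
    have xr: "x \<otimes> r' \<in> lower (m + a)" using lower_mult[OF x r(1)] c xc by (simp add: m_comm)
    consider "m + a < k" | "m + a = k" | "k < m + a" by linarith
    then show ?case
    proof cases
      case 1
      then have "x \<otimes> s \<in> lower k" using xs G_subset_lower by blast
      then have "w \<ominus> x \<otimes> s \<in> lower k" using K_subspaceD(6)[OF K_subspace_lower Suc.prems(3)] by blast
      moreover have "z \<oplus> (w \<ominus> x \<otimes> s) = x \<otimes> r' \<oplus> b"
      proof -
        have "z \<oplus> (w \<ominus> x \<otimes> s) = (z \<oplus> w) \<ominus> x \<otimes> s" using zc c xc by algebra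
        also have "\<dots> = x \<otimes> r' \<oplus> b" unfolding eq using c xc
          by algebra
        finally show ?thesis .
      qed
      ultimately show ?thesis using Suc.IH[OF r(1) Suc.prems(2)] by blast
    next
      case 2
      have "(z \<ominus> x \<otimes> s) \<oplus> (w \<ominus> x \<otimes> r') = (z \<oplus> w) \<ominus> (x \<otimes> r' \<oplus> x \<otimes> s)"
        using zc c xc by algebra
      also have "\<dots> = b" unfolding eq using c xc
        by algebra
      finally have "(z \<ominus> x \<otimes> s) \<oplus> (w \<ominus> x \<otimes> r') \<in> I" using Suc.prems(2) by simp
      moreover have "z \<ominus> x \<otimes> s \<in> G k" using K_subspaceD(6)[OF K_subspace_G z] xs 2 by blast
      moreover have "w \<ominus> x \<otimes> r' \<in> lower k" using K_subspaceD(6)[OF K_subspace_lower Suc.prems(3)] xr 2 by blast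
      ultimately have "z \<ominus> x \<otimes> s \<in> I" using homogeneous_idealD[OF I] by blast
      then show ?thesis using r(2) 2 by auto
    next
      case 3
      have "x \<otimes> s \<oplus> (x \<otimes> r' \<ominus> (z \<oplus> w)) = \<ominus> b" unfolding eq using c xc
        by algebra
      then have "x \<otimes> s \<oplus> (x \<otimes> r' \<ominus> (z \<oplus> w)) \<in> I" using Id(4)[OF Suc.prems(2)] by simp
      moreover have "x \<otimes> r' \<ominus> (z \<oplus> w) \<in> lower (m + a)"
        using xr z Suc.prems(3) 3 G_subset_lower[OF 3] lower_mono[of k "m + a"]
        by (intro K_subspaceD(3,6)[OF K_subspace_lower]) auto
      ultimately have "x \<otimes> s \<in> I" using homogeneous_idealD[OF I xs] by blast
      then have "x \<otimes> s \<oplus> b \<in> I" using Id(3) Suc.prems(2) by blast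
      moreover have "z \<oplus> w = x \<otimes> r' \<oplus> (x \<otimes> s \<oplus> b)" using eq c xc by (simp add: a_assoc)
      ultimately show ?thesis using Suc.IH[OF r(1) _ Suc.prems(3)] by blast
    qed
  }
qed

lemma adjoin_cases:
  assumes I: "homogeneous_ideal I" and x: "x \<in> G a" and z: "z \<in> G k" and w: "w \<in> lower k"
    and zw: "z \<oplus> w \<in> adjoin I x"
  shows "z \<in> I \<or> a \<le> k \<and> (\<exists>s\<in>G (k - a). z \<ominus> x \<otimes> s \<in> I)"
proof -
  obtain r b where r: "z \<oplus> w = x \<otimes> r \<oplus> b" "r \<in> carrier R" "b \<in> I" using zw by (auto simp: adjoin_def)
  obtain m where "r \<in> lower m" using carrier_in_lower[OF r(2)] .
  from adjoin_leading[OF I x z this r(3) w r(1)] show ?thesis .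
qed

lemma mem_adjoinI:
  assumes "z \<ominus> x \<otimes> s \<in> I" "z \<in> carrier R" "x \<in> carrier R" "s \<in> carrier R"
  shows "z \<in> adjoin I x"
proof -
  have "z = x \<otimes> s \<oplus> (z \<ominus> x \<otimes> s)"
    using assms by (simp add: a_minus_def a_lcomm r_neg)
  then show ?thesis using assms unfolding adjoin_def by blast
qed

lemma homogeneous_adjoin:
  assumes I: "homogeneous_ideal I" and x: "x \<in> G a"
  shows "homogeneous_ideal (adjoin I x)"
  unfolding homogeneous_ideal_def
proof (intro conjI allI ballI impI)
  have xc: "x \<in> carrier R" using x G_carrier by blast
  show "ideal (adjoin I x) R" using ideal_adjoin[OF homogeneous_ideal_ideal[OF I] xc] .
  fix k z w assume z: "z \<in> G k" and w: "w \<in> lower k" and zw: "z \<oplus> w \<in> adjoin I x"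
  from adjoin_cases[OF assms this] show "z \<in> adjoin I x"
    using adjoin_incl(1)[OF homogeneous_ideal_ideal[OF I] xc] mem_adjoinI[OF _ _ xc] z G_carrier by blast
qed

text \<open>Brings the degree \<open>k\<close> part of \<open>I + xR\<close> into the form whose
  dimension \<open>kdim_mult_sum\<close> computes. The multiplier may be taken homogeneous of degree
  \<open>k - a\<close>.\<close>

lemma G_Int_adjoin:
  assumes I: "homogeneous_ideal I" and x: "x \<in> G a"
  shows "k < a \<Longrightarrow> G k \<inter> adjoin I x = G k \<inter> I"
    "a \<le> k \<Longrightarrow> G k \<inter> adjoin I x = {x \<otimes> y \<oplus> b |y b. y \<in> G (k - a) \<and> b \<in> G k \<inter> I}"
proof -
  have xc: "x \<in> carrier R" using x G_carrier by blast
  note Id = idealD[OF homogeneous_ideal_ideal[OF I]]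
  have cases: "z \<in> I \<or> a \<le> k \<and> (\<exists>s\<in>G (k - a). z \<ominus> x \<otimes> s \<in> I)" if "z \<in> G k" "z \<in> adjoin I x" for z
  proof -
    have "z \<oplus> \<zero> \<in> adjoin I x" using that G_carrier by (simp add: subset_iff)
    from adjoin_cases[OF I x that(1) _ this] show ?thesis using K_subspaceD(2)[OF K_subspace_lower] by blast
  qed
  note incl = adjoin_incl(1)[OF homogeneous_ideal_ideal[OF I] xc]
  show "G k \<inter> adjoin I x = G k \<inter> I" if "k < a"
    using cases incl that by auto
  assume a: "a \<le> k"
  show "G k \<inter> adjoin I x = {x \<otimes> y \<oplus> b |y b. y \<in> G (k - a) \<and> b \<in> G k \<inter> I}"
  proof (intro equalityI subsetI)
    fix z assume z: "z \<in> G k \<inter> adjoin I x"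
    then have zc: "z \<in> carrier R" using G_carrier by blast
    show "z \<in> {x \<otimes> y \<oplus> b |y b. y \<in> G (k - a) \<and> b \<in> G k \<inter> I}"
    proof (cases "z \<in> I")
      case True
      have "z = x \<otimes> \<zero> \<oplus> z" using xc zc by simp
      then show ?thesis using True z K_subspaceD(2)[OF K_subspace_G] by blast
    next
      case False
      then obtain s where s: "s \<in> G (k - a)" "z \<ominus> x \<otimes> s \<in> I" using cases z by blast
      have sc: "s \<in> carrier R" using s G_carrier by blast
      have "x \<otimes> s \<in> G k" using mult_G[OF x s(1)] a by simp
      then have "z \<ominus> x \<otimes> s \<in> G k" using K_subspaceD(6)[OF K_subspace_G] z by blast
      moreover have "z = x \<otimes> s \<oplus> (z \<ominus> x \<otimes> s)"
        using xc zc sc by (simp add: a_minus_def a_lcomm r_neg)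
      ultimately show ?thesis using s by blast
    qed
  next
    fix z assume "z \<in> {x \<otimes> y \<oplus> b |y b. y \<in> G (k - a) \<and> b \<in> G k \<inter> I}"
    then obtain y b where y: "z = x \<otimes> y \<oplus> b" "y \<in> G (k - a)" "b \<in> G k" "b \<in> I" by blast
    have "x \<otimes> y \<in> G k" using mult_G[OF x y(2)] a by simp
    then have "z \<in> G k" using K_subspaceD(3)[OF K_subspace_G] y by blast
    moreover have "z \<in> adjoin I x" unfolding adjoin_def using y G_carrier by blast
    ultimately show "z \<in> G k \<inter> adjoin I x" by blast
  qed
qed

lemma G_Int_ideal_fin_dim: "ideal I R \<Longrightarrow> fin_dim_subspace (G i \<inter> I)"
  by (rule kdim_mono(1)[OF G_fin_dim]) (auto intro: K_subspace_Int K_subspace_G K_subspace_ideal)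

text \<open>The degree \<open>k\<close> part of the exact sequence relating \<open>R/(I:x)\<close>
  shifted by \<open>a\<close>, \<open>R/I\<close> and \<open>R/(I + xR)\<close>. Below degree
  \<open>a\<close> the shifted module is zero, which the conditional makes explicit because
  \<open>k - a\<close> would truncate.\<close>

lemma hilb_adjoin:
  assumes I: "homogeneous_ideal I" and x: "x \<in> G a"
  shows "hilb I k = hilb (adjoin I x) k + (if a \<le> k then hilb (colon I x) (k - a) else 0)"
proof (cases "a \<le> k")
  case True
  have xc: "x \<in> carrier R" using x G_carrier by blast
  have "{y \<in> G (k - a). x \<otimes> y \<in> G k \<inter> I} = G (k - a) \<inter> colon I x"
    using mult_G[OF x, of _ "k - a"] True G_carrier by (auto simp: colon_def)
  then have "kdim (G k \<inter> adjoin I x) + kdim (G (k - a) \<inter> colon I x) = kdim (G (k - a)) + kdim (G k \<inter> I)"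
    using kdim_mult_sum(2)[OF xc G_fin_dim G_Int_ideal_fin_dim[OF homogeneous_ideal_ideal[OF I]], of "k - a" k]
    unfolding G_Int_adjoin(2)[OF I x True] by simp
  then show ?thesis using True by (simp add: hilb_def)
next
  case False
  then show ?thesis using G_Int_adjoin(1)[OF I x, of k] by (simp add: hilb_def)
qed

lemma hilb_sum_adjoin:
  assumes I: "homogeneous_ideal I" and x: "x \<in> G a" and t: "a \<le> t"
  shows "hilb_sum I t = hilb_sum (adjoin I x) t + hilb_sum (colon I x) (t - a)"
proof -
  have "(\<Sum>k\<le>t. if a \<le> k then hilb (colon I x) (k - a) else 0) = (\<Sum>k\<le>t - a. hilb (colon I x) k)"
    using t
  proof (induction t rule: dec_induct)
    case base
    have "(\<Sum>k\<le>a. if a \<le> k then hilb (colon I x) (k - a) else 0)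
        = (\<Sum>k\<in>{a}. if a \<le> k then hilb (colon I x) (k - a) else 0)"
      by (rule sum.mono_neutral_right) auto
    then show ?case by simp
  next
    case (step n)
    then show ?case by (simp add: Suc_diff_le)
  qed
  then show ?thesis unfolding hilb_sum_def hilb_adjoin[OF I x] by (simp add: sum.distrib)
qed

lemma hilb_antimono: "\<lbrakk>ideal I R; ideal J R; I \<subseteq> J\<rbrakk> \<Longrightarrow> hilb J i \<le> hilb I i"
  using kdim_mono(2)[OF G_Int_ideal_fin_dim[of J i], of "G i \<inter> I"]
  by (auto simp: hilb_def intro: K_subspace_Int K_subspace_G K_subspace_ideal)

lemma hilb_carrier: "hilb (carrier R) i = 0"
  using G_carrier by (simp add: hilb_def Int_absorb2)

text \<open>For a homogeneous ideal, primality need only be tested with one homogeneous factor.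
  Given a product in \<open>I\<close>, a leading component lying in \<open>I\<close> is removed and
  induction on the degrees applies; otherwise the product \<open>s \<otimes> u\<close> of the
  leading components is in \<open>I\<close>, so \<open>u \<in> colon I s \<subseteq> I\<close>, a
  contradiction.\<close>

lemma homogeneous_prime:
  assumes I: "homogeneous_ideal I" and ne: "I \<noteq> carrier R"
    and colon: "\<And>a x. \<lbrakk>x \<in> G a; x \<notin> I\<rbrakk> \<Longrightarrow> colon I x \<subseteq> I"
  shows "primeideal I R"
proof (rule primeidealI[OF homogeneous_ideal_ideal[OF I] is_cring])
  note Id = idealD[OF homogeneous_ideal_ideal[OF I]]
  show "carrier R \<noteq> I" using ne by blast
  have main: "x \<in> lower k \<Longrightarrow> y \<in> lower l \<Longrightarrow> x \<otimes> y \<in> I \<Longrightarrow> x \<in> I \<or> y \<in> I" for k l x y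
  proof (induction "k + l" arbitrary: k l x y rule: less_induct)
    case less
    have xy: "x \<in> carrier R" "y \<in> carrier R" using less.prems lower_carrier by blast+
    show ?case
    proof (cases "k = 0 \<or> l = 0")
      case True
      then show ?thesis using less.prems Id(2) by auto
    next
      case False
      then obtain k' l' where kl: "k = Suc k'" "l = Suc l'" by (metis not0_implies_Suc)
      obtain x' s where x: "x' \<in> lower k'" "s \<in> G k'" "x = x' \<oplus> s" using less.prems(1) kl by auto
      obtain y' u where y: "y' \<in> lower l'" "u \<in> G l'" "y = y' \<oplus> u" using less.prems(2) kl by auto
      have c: "x' \<in> carrier R" "s \<in> carrier R" "y' \<in> carrier R" "u \<in> carrier R"
        using x y G_carrier lower_carrier by blast+
      show ?thesis
      proof (cases "s \<in> I")
        case True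
        have "x' \<otimes> y = x \<otimes> y \<oplus> \<ominus> (y \<otimes> s)"
          using x(3) c xy by (simp add: l_distr a_assoc m_comm[of s y] r_neg)
        then have "x' \<otimes> y \<in> I" using Id(3-5) less.prems(3) True xy by simp
        then have "x' \<in> I \<or> y \<in> I" using less.hyps[OF _ x(1) less.prems(2)] kl by simp
        then show ?thesis using x(3) True Id(3) by blast
      next
        case s: False
        show ?thesis
        proof (cases "u \<in> I")
          case True
          have "x \<otimes> y' = x \<otimes> y \<oplus> \<ominus> (x \<otimes> u)"
            using y(3) c xy by (simp add: r_distr a_assoc r_neg)
          then have "x \<otimes> y' \<in> I" using Id(3-5) less.prems(3) True xy by simp
          then have "x \<in> I \<or> y' \<in> I" using less.hyps[OF _ less.prems(1) y(1)] kl by simp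
          then show ?thesis using y(3) True Id(3) by blast
        next
          case False
          have "x \<otimes> y = s \<otimes> u \<oplus> (y' \<otimes> s \<oplus> (x' \<otimes> y' \<oplus> x' \<otimes> u))"
            using x(3) y(3) c by (simp add: l_distr r_distr a_ac m_comm[of s y'])
          moreover have "y' \<otimes> s \<oplus> (x' \<otimes> y' \<oplus> x' \<otimes> u) \<in> lower (k' + l')"
            using lower_mult[OF x(2) y(1)] lower_mult[OF y(2) x(1)] lower_mult_lower[OF x(1) y(1)]
            by (intro K_subspaceD(3)[OF K_subspace_lower]) (simp_all add: add.commute)
          ultimately have "s \<otimes> u \<in> I"
            using homogeneous_idealD[OF I mult_G[OF x(2) y(2)]] less.prems(3) by simp
          then have "u \<in> colon I s" using c by (simp add: colon_def)
          then show ?thesis using colon[OF x(2) s] False by blast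
        qed
      qed
    qed
  qed
  fix x y assume "x \<in> carrier R" "y \<in> carrier R" "x \<otimes> y \<in> I"
  then show "x \<in> I \<or> y \<in> I" using main carrier_in_lower by metis
qed

section \<open>Hilbert functions and Krull dimension\<close>

definition prime_chain :: "(nat \<Rightarrow> 'a set) \<Rightarrow> nat \<Rightarrow> bool"
  where "prime_chain P n \<longleftrightarrow> (\<forall>i\<le>n. primeideal (P i) R) \<and> (\<forall>i<n. P i \<subset> P (Suc i))"

lemma prime_chain_Cons:
  assumes "prime_chain P n" "primeideal Q R" "Q \<subset> P 0"
  shows "prime_chain (case_nat Q P) (Suc n)"
  using assms unfolding prime_chain_def by (auto split: nat.split)

lemma hilb_sum_carrier: "hilb_sum (carrier R) t = 0"
  by (simp add: hilb_sum_def hilb_carrier)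

lemma one_notin_ideal: "\<lbrakk>ideal I R; I \<noteq> carrier R\<rbrakk> \<Longrightarrow> \<one> \<notin> I"
  using ideal.one_imp_carrier by blast

text \<open>If all linear forms lie in \<open>I\<close>, then \<open>R/I\<close> lives in degree 0
  and the chain is \<open>I\<close> alone. Otherwise a linear form \<open>x\<close> outside the
  prime \<open>I\<close> is a nonzerodivisor on \<open>R/I\<close>, that is
  \<open>I : x = I\<close>. Going from \<open>I + xR\<close> to \<open>I\<close> then raises the
  order by one, keeps \<open>m\<close>, and prolongs the chain of primes by \<open>I\<close> at the
  bottom.\<close>

lemma hilb_growth_prime:
  assumes I: "homogeneous_ideal I" and P: "primeideal I R"
    and IH: "\<And>J. \<lbrakk>homogeneous_ideal J; J \<noteq> carrier R; I \<subset> J\<rbrakk> \<Longrightarrow>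
      \<exists>d m P. m \<ge> 1 \<and> has_growth (hilb_sum J) d (real m) \<and> prime_chain P d \<and> J \<subseteq> P 0"
  shows "\<exists>d m P. m \<ge> 1 \<and> has_growth (hilb_sum I) d (real m) \<and> prime_chain P d \<and> I \<subseteq> P 0"
proof -
  interpret primeideal I R by fact
  have idl: "ideal I R" by unfold_locales
  have one: "\<one> \<notin> I" using one_notin_ideal[OF idl] I_notcarr by blast
  show ?thesis
  proof (cases "G 1 \<subseteq> I")
    case True
    have "hilb I (Suc i) = 0" for i
      using G_subset_ideal[OF idl True, of "Suc i"] by (simp add: hilb_def Int_absorb2)
    then have "hilb_sum I t = hilb I 0" for t
      by (induction t) (simp_all add: hilb_sum_def)
    then have gr: "has_growth (hilb_sum I) 0 (hilb I 0)" by (simp add: has_growth_def)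
    have "G 0 \<inter> I \<subset> G 0" using one one_K G_0 by blast
    then have "kdim (G 0 \<inter> I) < kdim (G 0)"
      by (intro kdim_psubset[OF G_fin_dim] K_subspace_Int K_subspace_G K_subspace_ideal idl)
    moreover have "hilb I 0 = real (kdim (G 0) - kdim (G 0 \<inter> I))"
      using calculation by (simp add: hilb_def of_nat_diff)
    ultimately have "\<exists>m::nat. m \<ge> 1 \<and> hilb I 0 = real m" by (intro exI[of _ "kdim (G 0) - kdim (G 0 \<inter> I)"]) simp
    moreover have "prime_chain (\<lambda>_. I) 0" using P by (simp add: prime_chain_def)
    ultimately show ?thesis using gr by (metis order_refl)
  next
    case False
    then obtain x where x: "x \<in> G 1" "x \<notin> I" by blast
    have xc: "x \<in> carrier R" using x G_carrier by blast
    have colon: "colon I x = I"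
    proof (intro equalityI colon_incl[OF idl xc])
      show "colon I x \<subseteq> I" using I_prime[OF xc] x(2) by (auto simp: colon_def)
    qed
    have J: "homogeneous_ideal (adjoin I x)" by (rule homogeneous_adjoin[OF I x(1)])
    \<comment> \<open>As \<open>x\<close> has degree 1, adjoining it changes nothing in degree 0, so
      the larger ideal is still proper.\<close>
    have "G 0 \<inter> adjoin I x = G 0 \<inter> I" by (rule G_Int_adjoin(1)[OF I x(1)]) simp
    then have "\<one> \<notin> adjoin I x" using one one_K G_0 by blast
    then have "adjoin I x \<noteq> carrier R" using one_closed by blast
    moreover have sub: "I \<subset> adjoin I x" using adjoin_incl[OF idl xc] x(2) by blast
    ultimately obtain d m Q where d: "m \<ge> 1" "has_growth (hilb_sum (adjoin I x)) d (real m)"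
        "prime_chain Q d" "adjoin I x \<subseteq> Q 0"
      using IH[OF J] by blast
    have "hilb_sum I (Suc t) - hilb_sum I t = hilb_sum (adjoin I x) (Suc t)" for t
      using hilb_sum_adjoin[OF I x(1), of "Suc t"] by (simp add: colon)
    then have "has_growth (hilb_sum I) (Suc d) (real m)" using has_growth_sum d(2) by blast
    moreover have "prime_chain (case_nat I Q) (Suc d)"
      using prime_chain_Cons[OF d(3) P] sub d(4) by blast
    ultimately show ?thesis using d(1) by (metis nat.case(1) order_refl)
  qed
qed

text \<open>Noetherian induction on the ideal: an ideal that is not prime splits along the exact sequence
  \<open>0 \<rightarrow> R/(I:x)(-a) \<rightarrow> R/I \<rightarrow> R/(I+xR) \<rightarrow> 0\<close>.\<close>

lemma hilb_growth:
  assumes "homogeneous_ideal I" "I \<noteq> carrier R"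
  shows "\<exists>d m P. m \<ge> 1 \<and> has_growth (hilb_sum I) d (real m) \<and> prime_chain P d \<and> I \<subseteq> P 0"
proof (rule ccontr)
  define good where "good J \<longleftrightarrow>
    (\<exists>d m P. m \<ge> 1 \<and> has_growth (hilb_sum J) d (real m) \<and> prime_chain P d \<and> J \<subseteq> P 0)" for J
  define C where "C = {J. homogeneous_ideal J \<and> J \<noteq> carrier R \<and> \<not> good J}"
  assume "\<not> ?thesis"
  then have "I \<in> C" using assms by (simp add: C_def good_def)
  then obtain M where M: "M \<in> C" and max: "\<And>J. \<lbrakk>J \<in> C; M \<subseteq> J\<rbrakk> \<Longrightarrow> J = M"
    using ideals_have_maximal[of C] homogeneous_ideal_ideal unfolding C_def by blast
  have hM: "homogeneous_ideal M" and neM: "M \<noteq> carrier R" and bad: "\<not> good M"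
    using M by (simp_all add: C_def)
  note idM = homogeneous_ideal_ideal[OF hM]
  have IH: "good J" if "homogeneous_ideal J" "J \<noteq> carrier R" "M \<subset> J" for J
    using max[of J] that by (auto simp: C_def)
  have "\<not> primeideal M R"
    using hilb_growth_prime[OF hM] IH bad unfolding good_def by blast
  then obtain a x where x: "x \<in> G a" "x \<notin> M" "\<not> colon M x \<subseteq> M"
    using homogeneous_prime[OF hM neM] by blast
  have xc: "x \<in> carrier R" using x G_carrier by blast
  have c: "homogeneous_ideal (colon M x)" "colon M x \<noteq> carrier R" "M \<subset> colon M x"
  proof -
    show "homogeneous_ideal (colon M x)" by (rule homogeneous_colon[OF hM x(1)])
    have "\<one> \<notin> colon M x" using x(2) xc by (simp add: colon_def)
    then show "colon M x \<noteq> carrier R" using one_closed by blast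
    show "M \<subset> colon M x" using colon_incl[OF idM xc] x(3) by blast
  qed
  obtain d1 m1 P1 where 1: "m1 \<ge> 1" "has_growth (hilb_sum (colon M x)) d1 (real m1)"
      "prime_chain P1 d1" "colon M x \<subseteq> P1 0"
    using IH[OF c] unfolding good_def by blast
  have g1: "has_growth (\<lambda>t. hilb_sum (colon M x) (t - a)) d1 (real m1)"
    by (rule has_growth_shift[OF 1(2)])
  have M1: "M \<subseteq> P1 0" using c(3) 1(4) by blast
  have sum: "has_growth (hilb_sum M) d m"
    if "has_growth (\<lambda>t. hilb_sum (adjoin M x) t + hilb_sum (colon M x) (t - a)) d m" for d m
  proof (rule has_growth_cong[OF _ that])
    show "\<forall>\<^sub>F t in sequentially.
        hilb_sum (adjoin M x) t + hilb_sum (colon M x) (t - a) = hilb_sum M t"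
      using eventually_ge_at_top[of a]
      by eventually_elim (simp add: hilb_sum_adjoin[OF hM x(1)])
  qed
  have "good M"
  proof (cases "adjoin M x = carrier R")
    case True
    then have "has_growth (hilb_sum M) d1 (real m1)"
      using sum[of d1 "real m1"] g1 by (simp add: hilb_sum_carrier)
    then show ?thesis using 1 M1 unfolding good_def by blast
  next
    case False
    have "M \<subset> adjoin M x" using adjoin_incl[OF idM xc] x(2) by blast
    then obtain d2 m2 P2 where 2: "m2 \<ge> 1" "has_growth (hilb_sum (adjoin M x)) d2 (real m2)"
        "prime_chain P2 d2" "adjoin M x \<subseteq> P2 0"
      using IH[OF homogeneous_adjoin[OF hM x(1)] False] unfolding good_def by blast
    have M2: "M \<subseteq> P2 0" using \<open>M \<subset> adjoin M x\<close> 2(4) by blast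
    \<comment> \<open>The summand of larger order determines the growth and supplies the chain; at
      equal orders the positive integers add, so no cancellation can occur.\<close>
    consider "d1 < d2" | "d1 = d2" | "d2 < d1" by linarith
    then show ?thesis
    proof cases
      case 1
      then have "has_growth (hilb_sum M) d2 (real m2 + 0)"
        by (intro sum has_growth_add 2 has_growth_less[OF g1])
      then have "has_growth (hilb_sum M) d2 (real m2)" by simp
      then show ?thesis using 2 M2 unfolding good_def by blast
    next
      case eq: 2
      then have "has_growth (hilb_sum M) d1 (real m2 + real m1)"
        using 2(2) by (intro sum has_growth_add g1) simp
      then have "has_growth (hilb_sum M) d1 (real (m2 + m1))" by simp
      moreover have "m2 + m1 \<ge> 1" using 1(1) by simp
      ultimately show ?thesis using 1(3) M1 unfolding good_def by blast
    next
      case 3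
      then have "has_growth (hilb_sum M) d1 (0 + real m1)"
        by (intro sum has_growth_add g1 has_growth_less[OF 2(2)])
      then have "has_growth (hilb_sum M) d1 (real m1)" by simp
      then show ?thesis using 1 M1 unfolding good_def by blast
    qed
  qed
  with bad show False ..
qed

section \<open>Prime chains bound the growth from below\<close>

text \<open>The dimension of the image of \<open>lower t\<close> in \<open>R/I\<close>. It replaces
  the Hilbert sum for ideals that are not homogeneous.\<close>

definition lower_codim :: "'a set \<Rightarrow> nat \<Rightarrow> real"
  where "lower_codim I t = real (kdim (lower t)) - real (kdim (lower t \<inter> I))"

lemma lower_Int_ideal_fin_dim: "ideal I R \<Longrightarrow> fin_dim_subspace (lower t \<inter> I)"
  by (rule kdim_mono(1)[OF lower_fin_dim]) (auto intro: K_subspace_Int K_subspace_lower K_subspace_ideal)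

lemma lower_codim_nonneg: "ideal I R \<Longrightarrow> 0 \<le> lower_codim I t"
  using kdim_mono(2)[OF lower_fin_dim, of "lower t \<inter> I" t]
  by (simp add: lower_codim_def K_subspace_Int K_subspace_lower K_subspace_ideal)

text \<open>For \<open>x \<in> Q - P\<close>, the space \<open>xU + (P \<inter> U')\<close> with \<open>U = lower t\<close>, \<open>U' = lower (t + a)\<close> lies in
  \<open>Q \<inter> U'\<close>, and \<open>xy \<in> P\<close> only for \<open>y \<in> P\<close>.\<close>

lemma lower_codim_step:
  assumes P: "primeideal P R" and Q: "ideal Q R" and sub: "P \<subseteq> Q"
    and x: "x \<in> Q" "x \<notin> P" "x \<in> lower a"
  shows "lower_codim P (t + a) \<ge> lower_codim Q (t + a) + lower_codim P t"
proof -
  interpret P: primeideal P R by fact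
  have idP: "ideal P R" by unfold_locales
  have xc: "x \<in> carrier R" using x lower_carrier by blast
  let ?B = "lower (t + a) \<inter> P"
  let ?S = "{x \<otimes> y \<oplus> b |y b. y \<in> lower t \<and> b \<in> ?B}"
  note B = lower_Int_ideal_fin_dim[OF idP, of "t + a"]
  note S = kdim_mult_sum[OF xc lower_fin_dim B, of t]
  have xy: "x \<otimes> y \<in> lower (t + a)" if "y \<in> lower t" for y
    using lower_mult_lower[OF x(3) that] .
  have "?S \<subseteq> lower (t + a) \<inter> Q"
  proof
    fix p assume "p \<in> ?S"
    then obtain y b where p: "p = x \<otimes> y \<oplus> b" "y \<in> lower t" "b \<in> lower (t + a)" "b \<in> P" by blast
    have "y \<in> carrier R" using p(2) lower_carrier by blast
    then have "x \<otimes> y \<in> Q" using idealD(5)[OF Q x(1), of y] xc by (simp add: m_comm)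
    then have "p \<in> Q" using idealD(3)[OF Q] p(1,4) sub by blast
    moreover have "p \<in> lower (t + a)" using K_subspaceD(3)[OF K_subspace_lower xy[OF p(2)] p(3)] p(1) by simp
    ultimately show "p \<in> lower (t + a) \<inter> Q" by blast
  qed
  then have "kdim ?S \<le> kdim (lower (t + a) \<inter> Q)"
    by (intro kdim_mono(2)[OF lower_Int_ideal_fin_dim[OF Q]] fin_dim_K_subspace[OF S(1)])
  moreover have "{y \<in> lower t. x \<otimes> y \<in> ?B} = lower t \<inter> P"
  proof (intro equalityI subsetI)
    fix y assume "y \<in> {y \<in> lower t. x \<otimes> y \<in> ?B}"
    then have y: "y \<in> lower t" "x \<otimes> y \<in> P" by auto
    have "y \<in> carrier R" using y(1) lower_carrier by blast
    then have "y \<in> P" using P.I_prime[OF xc _ y(2)] x(2) by blast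
    then show "y \<in> lower t \<inter> P" using y(1) by blast
  next
    fix y assume y: "y \<in> lower t \<inter> P"
    then have "x \<otimes> y \<in> P" using idealD(5)[OF idP _ xc] by blast
    then show "y \<in> {y \<in> lower t. x \<otimes> y \<in> ?B}" using y xy by simp
  qed
  ultimately show ?thesis using S(2) by (simp add: lower_codim_def)
qed

text \<open>Induction from the top of the chain: an element of \<open>P 1\<close> outside
  \<open>P 0\<close> makes \<open>lower_codim_step\<close> applicable, and summing up its inequality
  raises the order by one. For a single prime, \<open>\<one> \<notin> P 0\<close> gives codimension
  at least 1.\<close>

lemma prime_chain_lower_bound:
  "prime_chain P n \<Longrightarrow> \<exists>c>0. \<exists>T. \<forall>t\<ge>T. lower_codim (P 0) t \<ge> c * real t ^ n"
proof (induction n arbitrary: P)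
  case 0
  have pr: "primeideal (P 0) R" using 0 by (simp add: prime_chain_def)
  interpret P: primeideal "P 0" R by (rule pr)
  have idP: "ideal (P 0) R" by unfold_locales
  have "lower_codim (P 0) t \<ge> 1 * real t ^ 0" if "t \<ge> 1" for t
  proof -
    have "\<one> \<in> lower t" using G_subset_lower[of 0 t] that G_0 one_K by auto
    moreover have "\<one> \<notin> P 0" using one_notin_ideal[OF idP] P.I_notcarr by blast
    ultimately have "kdim (lower t \<inter> P 0) < kdim (lower t)"
      by (intro kdim_psubset[OF lower_fin_dim] K_subspace_Int K_subspace_lower K_subspace_ideal idP) blast
    then show ?thesis by (simp add: lower_codim_def)
  qed
  then show ?case by (intro exI[of _ 1]) auto
next
  case (Suc n)
  have "prime_chain (\<lambda>i. P (Suc i)) n" using Suc.prems by (simp add: prime_chain_def)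
  from Suc.IH[OF this] obtain c T where c: "c > 0" "\<And>t. t \<ge> T \<Longrightarrow> lower_codim (P 1) t \<ge> c * real t ^ n"
    by auto
  have pr: "primeideal (P 0) R" "primeideal (P 1) R" and sub: "P 0 \<subset> P 1"
    using Suc.prems by (auto simp: prime_chain_def)
  have idl: "ideal (P 0) R" "ideal (P 1) R" using pr by (simp_all add: primeideal_def)
  obtain x where x: "x \<in> P 1" "x \<notin> P 0" using sub by blast
  obtain a where "x \<in> lower a" using carrier_in_lower[of x] x idealD(1)[OF idl(2)] by blast
  \<comment> \<open>Passing to \<open>Suc a\<close> makes the shift positive, as
    \<open>power_lower_bound_step\<close> demands.\<close>
  then have xa: "x \<in> lower (Suc a)" using lower_mono[of a "Suc a"] by auto
  show ?case
  proof (rule power_lower_bound_step[where B = "lower_codim (P 1)" and a = "Suc a"])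
    show "lower_codim (P 0) t \<ge> 0" for t by (rule lower_codim_nonneg[OF idl(1)])
    show "lower_codim (P 0) (t + Suc a) \<ge> lower_codim (P 1) (t + Suc a) + lower_codim (P 0) t" for t
      using lower_codim_step[OF pr(1) idl(2) _ x xa] sub by blast
  qed (use c in auto)
qed

lemma zero_ne_carrier: "{\<zero>} \<noteq> carrier R"
  using one_not_zero one_closed by blast

lemma hilb_zero: "hilb {\<zero>} i = real (kdim (G i))"
proof -
  have "G i \<inter> {\<zero>} = {\<zero>}" using K_subspaceD(2)[OF K_subspace_G] by blast
  then show ?thesis by (simp add: hilb_def kdim_zero)
qed

lemma prime_chain_length_le:
  assumes "has_growth (hilb_sum {\<zero>}) d m" "prime_chain P n"
  shows "n \<le> d"
proof -
  obtain c T where c: "c > 0" "\<And>t. t \<ge> T \<Longrightarrow> lower_codim (P 0) t \<ge> c * real t ^ n"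
    using prime_chain_lower_bound[OF assms(2)] by blast
  show ?thesis
  proof (rule has_growth_degree_ge[OF assms(1) c(1)])
    fix t assume t: "t \<ge> T"
    have "lower_codim (P 0) t \<le> real (kdim (lower t))" by (simp add: lower_codim_def)
    \<comment> \<open>\<open>hilb_sum\<close> includes degree \<open>t\<close>, whereas
      \<open>lower t\<close> stops just before it.\<close>
    also have "\<dots> \<le> real (kdim (lower (Suc t)))"
      using kdim_mono(2)[OF lower_fin_dim lower_Suc_mono K_subspace_lower] by simp
    also have "\<dots> \<le> hilb_sum {\<zero>} t"
      using of_nat_mono[OF kdim_lower_le[of t], where 'a = real] by (simp add: hilb_sum_def hilb_zero)
    finally show "c * real t ^ n \<le> hilb_sum {\<zero>} t" using c(2)[OF t] by linarith
  qed
qed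

text \<open>The chain supplied by \<open>hilb_growth\<close> for the zero ideal has length equal to
  the order of growth, and no chain is longer by \<open>prime_chain_length_le\<close>. The last
  conclusion bounds the orders belonging to other ideals.\<close>

lemma krull_dim_growth:
  obtains d m where "m \<ge> 1" "krull_dim R = enat d" "has_growth (hilb_sum {\<zero>}) d (real m)"
    "\<And>P n. prime_chain P n \<Longrightarrow> n \<le> d"
proof -
  obtain d m P where d: "m \<ge> 1" "has_growth (hilb_sum {\<zero>}) d (real m)" "prime_chain P d"
    using hilb_growth[OF homogeneous_zero zero_ne_carrier] by blast
  note le = prime_chain_length_le[OF d(2)]
  have "krull_dim R = Sup {enat n |n. \<exists>P. prime_chain P n}"
    unfolding krull_dim_def prime_chain_def ..
  also have "\<dots> = enat d"
  proof (rule antisym)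
    show "Sup {enat n |n. \<exists>P. prime_chain P n} \<le> enat d" by (rule Sup_least) (use le in auto)
    show "enat d \<le> Sup {enat n |n. \<exists>P. prime_chain P n}" by (rule Sup_upper) (use d(3) in auto)
  qed
  finally show ?thesis using that d(1,2) le by blast
qed

section \<open>Multiplicities and the minimum distance\<close>

definition multiplicity :: "'a set \<Rightarrow> real"
  where "multiplicity I = (let d = the_enat (krull_dim R) in lim (\<lambda>t. fact d * hilb_sum I t / real t ^ d))"

lemma multiplicity_self: "hilbert_samuel_multiplicity R K (self_module R) G = multiplicity {\<zero>}"
proof -
  have "real (hilbert_function R K (self_module R) G i) = hilb {\<zero>} i" for i
    by (simp add: hilbert_function_def kdim_def hilb_zero)
  then show ?thesis
    by (simp add: hilbert_samuel_multiplicity_def multiplicity_def hilb_sum_def)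
qed

lemma multiplicity_quot:
  assumes "ideal I R"
  shows "hilbert_samuel_multiplicity R K (quot_module R I) (quot_grading R G I) = multiplicity I"
proof -
  have "real (hilbert_function R K (quot_module R I) (quot_grading R G I) i) = hilb I i" for i
    using kdim_quotient[OF assms G_fin_dim, of i] by (simp add: hilbert_function_def hilb_def)
  then show ?thesis
    by (simp add: hilbert_samuel_multiplicity_def multiplicity_def hilb_sum_def)
qed

text \<open>The order \<open>n\<close> found for \<open>I\<close> is the length of a chain of primes
  of \<open>R\<close>, hence at most the Krull dimension; if it is smaller, renormalising gives the
  limit 0.\<close>

lemma hilb_growth_krull_dim:
  assumes I: "homogeneous_ideal I"
  obtains m :: nat where "has_growth (hilb_sum I) (the_enat (krull_dim R)) (real m)"
proof -
  obtain d where d: "krull_dim R = enat d" and le: "\<And>P n. prime_chain P n \<Longrightarrow> n \<le> d"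
    using krull_dim_growth by metis
  show ?thesis
  proof (cases "I = carrier R")
    case True
    then have "has_growth (hilb_sum I) d 0" by (simp add: has_growth_def hilb_sum_carrier)
    then show ?thesis using that[of 0] d by simp
  next
    case False
    then obtain n m P where n: "has_growth (hilb_sum I) n (real m)" "prime_chain P n"
      using hilb_growth[OF I] by blast
    show ?thesis
    proof (cases "n = d")
      case True
      then show ?thesis using that n(1) d by simp
    next
      case False
      then have "has_growth (hilb_sum I) d 0"
        using has_growth_less[OF n(1), of d] le[OF n(2)] by simp
      then show ?thesis using that[of 0] d by simp
    qed
  qed
qed

lemma multiplicity_growth:
  assumes "has_growth (hilb_sum I) (the_enat (krull_dim R)) m"
  shows "multiplicity I = m"
  using limI assms unfolding multiplicity_def has_growth_def by (simp add: Let_def)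

lemma multiplicity_nat:
  assumes "homogeneous_ideal I"
  shows "\<exists>m. multiplicity I = real m"
  using hilb_growth_krull_dim[OF assms] multiplicity_growth by metis

text \<open>Hilbert functions compare degree by degree, and since both limits exist the inequality
  passes to them.\<close>

lemma multiplicity_antimono:
  assumes "homogeneous_ideal I" "homogeneous_ideal J" "I \<subseteq> J"
  shows "multiplicity J \<le> multiplicity I"
proof -
  let ?d = "the_enat (krull_dim R)"
  obtain m n where m: "has_growth (hilb_sum I) ?d m" and n: "has_growth (hilb_sum J) ?d n"
    using hilb_growth_krull_dim assms(1,2) by metis
  have "fact ?d * hilb_sum J t / real t ^ ?d \<le> fact ?d * hilb_sum I t / real t ^ ?d" for t
    unfolding hilb_sum_def
    using hilb_antimono[OF assms(1,2)[THEN homogeneous_ideal_ideal] assms(3)]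
    by (intro divide_right_mono mult_left_mono sum_mono) auto
  then have "n \<le> m"
    by (intro LIMSEQ_le[OF n[unfolded has_growth_def] m[unfolded has_growth_def]]) blast
  then show ?thesis using multiplicity_growth m n by simp
qed

section \<open>Ideals generated by families and the passage to the next degree\<close>

lemma homogeneous_genideal:
  assumes "finite F" "F \<subseteq> G t"
  shows "homogeneous_ideal (Idl F)"
  using assms
proof (induction F rule: finite_induct)
  case empty
  have "Idl {} = {\<zero>}"
  proof
    show "Idl {} \<subseteq> {\<zero>}" by (rule genideal_minimal[OF zeroideal]) simp
    show "{\<zero>} \<subseteq> Idl {}" using idealD(2)[OF genideal_ideal[of "{}"]] by simp
  qed
  then show ?case using homogeneous_zero by simp
next
  case (insert x F)
  have xG: "x \<in> G t" and F: "F \<subseteq> carrier R" and h: "homogeneous_ideal (Idl F)"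
    using insert G_carrier by auto
  have xc: "x \<in> carrier R" using xG G_carrier by blast
  have xF: "insert x F \<subseteq> carrier R" using xc F by blast
  note idF = homogeneous_ideal_ideal[OF h]
  \<comment> \<open>\<open>adjoin\<close> by a homogeneous element preserves homogeneity, so
    generators are added one at a time.\<close>
  have "Idl (insert x F) = adjoin (Idl F) x"
  proof
    show "Idl (insert x F) \<subseteq> adjoin (Idl F) x"
      using genideal_minimal[OF ideal_adjoin[OF idF xc]] adjoin_incl[OF idF xc] genideal_self[OF F] by blast
    have "insert x F \<subseteq> Idl (insert x F)" by (rule genideal_self[OF xF])
    moreover have "Idl F \<subseteq> Idl (insert x F)"
      using calculation by (intro genideal_minimal[OF genideal_ideal[OF xF]]) blast
    ultimately show "adjoin (Idl F) x \<subseteq> Idl (insert x F)"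
      by (intro adjoin_least[OF genideal_ideal[OF xF]]) blast+
  qed
  then show ?case using homogeneous_adjoin[OF h xG] by simp
qed

text \<open>A maximal annihilator among those of the nonzero multiples of \<open>v\<close> is prime; were \<open>v\<close> in it,
  say \<open>v (v w) = 0\<close>, then \<open>(v w)\<^sup>2 = 0\<close>, contradicting reducedness.\<close>

lemma exists_prime_annihilator:
  assumes red: "reduced_ring R" and v: "v \<in> carrier R" "v \<noteq> \<zero>"
  obtains u where "u \<in> carrier R" "u \<otimes> v \<noteq> \<zero>"
    "\<And>a b. \<lbrakk>a \<in> carrier R; b \<in> carrier R; u \<otimes> (a \<otimes> b) = \<zero>; u \<otimes> a \<noteq> \<zero>\<rbrakk> \<Longrightarrow> u \<otimes> b = \<zero>"
proof -
  define C where "C = {colon {\<zero>} (v \<otimes> w) |w. w \<in> carrier R \<and> v \<otimes> w \<noteq> \<zero>}"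
  have "v \<otimes> \<one> \<noteq> \<zero>" using v by simp
  then have "colon {\<zero>} (v \<otimes> \<one>) \<in> C" unfolding C_def using one_closed by blast
  moreover have "ideal I R" if "I \<in> C" for I
    using that ideal_colon[OF zeroideal] v(1) by (auto simp: C_def)
  ultimately obtain M where M: "M \<in> C" and max: "\<And>J. \<lbrakk>J \<in> C; M \<subseteq> J\<rbrakk> \<Longrightarrow> J = M"
    using ideals_have_maximal[of C] by blast
  obtain w where w: "w \<in> carrier R" "v \<otimes> w \<noteq> \<zero>" "M = colon {\<zero>} (v \<otimes> w)" using M by (auto simp: C_def)
  define u where "u = v \<otimes> w"
  have u: "u \<in> carrier R" using v(1) w(1) by (simp add: u_def)
  show ?thesis
  proof (rule that[OF u])
    show "u \<otimes> v \<noteq> \<zero>"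
    proof
      assume "u \<otimes> v = \<zero>"
      then have "(u \<otimes> v) \<otimes> w = \<zero>" using w(1) by simp
      then have "u \<otimes> u = \<zero>" using u v(1) w(1) by (simp add: u_def m_assoc)
      then have "u [^] (2::nat) = \<zero>" using u by (simp add: numeral_2_eq_2)
      then have "u = \<zero>" using red u unfolding reduced_ring_def by blast
      then show False using w(2) by (simp add: u_def)
    qed
    fix a b assume ab: "a \<in> carrier R" "b \<in> carrier R" "u \<otimes> (a \<otimes> b) = \<zero>" "u \<otimes> a \<noteq> \<zero>"
    have ua: "v \<otimes> (w \<otimes> a) = u \<otimes> a" using v(1) w(1) ab(1) by (simp add: u_def m_assoc)
    have "colon {\<zero>} (v \<otimes> (w \<otimes> a)) \<in> C"
      unfolding C_def mem_Collect_eq by (rule exI[of _ "w \<otimes> a"]) (use w(1) ab(1,4) ua in simp)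
    moreover have "M \<subseteq> colon {\<zero>} (v \<otimes> (w \<otimes> a))"
    proof
      fix r assume "r \<in> M"
      then have r: "r \<in> carrier R" "u \<otimes> r = \<zero>" by (simp_all add: w(3) u_def colon_def)
      have "(u \<otimes> a) \<otimes> r = (u \<otimes> r) \<otimes> a" using u ab(1) r(1) by (simp add: m_ac)
      then show "r \<in> colon {\<zero>} (v \<otimes> (w \<otimes> a))" using r ab(1) by (simp add: ua colon_def)
    qed
    \<comment> \<open>As \<open>u \<otimes> a\<close> is again a nonzero multiple of
      \<open>v\<close>, maximality makes its annihilator equal to that of \<open>u\<close>. What
      kills \<open>u \<otimes> a\<close>, such as \<open>b\<close>, therefore kills
      \<open>u\<close>.\<close>
    ultimately have "colon {\<zero>} (u \<otimes> a) = M" using max[of "colon {\<zero>} (u \<otimes> a)"] unfolding ua by blast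
    moreover have "b \<in> colon {\<zero>} (u \<otimes> a)" using ab u by (simp add: colon_def m_assoc)
    ultimately show "u \<otimes> b = \<zero>" by (simp add: w(3) u_def colon_def)
  qed
qed

text \<open>Over a finite field there need not be a linear nonzerodivisor, so \<open>V\<close> cannot simply be
  multiplied by one. Instead, pick \<open>0 \<noteq> v \<in> V\<close> and a prime annihilator \<open>P = Ann u\<close> avoiding \<open>v\<close>,
  multiply \<open>V / (V \<inter> P) \<cong> uV\<close> by a linear form outside \<open>P\<close>, and treat \<open>V \<inter> P\<close> by induction.\<close>

lemma kdim_le_kdim_shift:
  assumes red: "reduced_ring R" and t: "t \<ge> 1"
  shows "\<lbrakk>fin_dim_subspace V; V \<subseteq> G t; fin_dim_subspace W;
    \<And>x y. \<lbrakk>x \<in> G 1; y \<in> V\<rbrakk> \<Longrightarrow> x \<otimes> y \<in> W\<rbrakk> \<Longrightarrow> kdim V \<le> kdim W"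
proof (induction "kdim V" arbitrary: V W rule: less_induct)
  case less
  note Vs = K_subspaceD[OF fin_dim_K_subspace[OF less.prems(1)]]
  note Ws = K_subspaceD[OF fin_dim_K_subspace[OF less.prems(3)]]
  show ?case
  proof (cases "V = {\<zero>}")
    case True
    then show ?thesis by (simp add: kdim_zero)
  next
    case False
    then obtain v where v: "v \<in> V" "v \<noteq> \<zero>" using Vs(2) by blast
    have vc: "v \<in> carrier R" using v(1) Vs(1) by blast
    obtain u where u: "u \<in> carrier R" "u \<otimes> v \<noteq> \<zero>"
      and prime: "\<And>a b. \<lbrakk>a \<in> carrier R; b \<in> carrier R; u \<otimes> (a \<otimes> b) = \<zero>; u \<otimes> a \<noteq> \<zero>\<rbrakk> \<Longrightarrow> u \<otimes> b = \<zero>"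
      using exists_prime_annihilator[OF red vc v(2)] by blast
    \<comment> \<open>Otherwise \<open>u\<close> would kill all of \<open>G t\<close>, as
      \<open>t \<ge> 1\<close>, and in particular \<open>v\<close>.\<close>
    have "\<not> G 1 \<subseteq> colon {\<zero>} u"
    proof
      assume "G 1 \<subseteq> colon {\<zero>} u"
      then have "G t \<subseteq> colon {\<zero>} u" using G_subset_ideal[OF ideal_colon[OF zeroideal u(1)]] t by blast
      then show False using v(1) less.prems(2) u(2) by (auto simp: colon_def)
    qed
    then obtain x where x: "x \<in> G 1" "x \<notin> colon {\<zero>} u" by blast
    have xc: "x \<in> carrier R" using x(1) G_carrier by blast
    have ux: "u \<otimes> x \<noteq> \<zero>" using x(2) xc by (simp add: colon_def)
    let ?V = "{y \<in> V. u \<otimes> y = \<zero>}" and ?W = "{y \<in> W. u \<otimes> y = \<zero>}"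
    have eqV: "?V = V \<inter> colon {\<zero>} u" and eqW: "?W = W \<inter> colon {\<zero>} u"
      using Vs(1) Ws(1) by (auto simp: colon_def)
    have sub: "K_subspace ?V" "K_subspace ?W"
      unfolding eqV eqW by (intro K_subspace_Int fin_dim_K_subspace less.prems(1,3)
        K_subspace_ideal[OF ideal_colon[OF zeroideal u(1)]])+
    have fV: "fin_dim_subspace ?V" by (rule kdim_mono(1)[OF less.prems(1) _ sub(1)]) blast
    have fW: "fin_dim_subspace ?W" by (rule kdim_mono(1)[OF less.prems(3) _ sub(2)]) blast
    have "?V \<subset> V" using v(1) u(2) by blast
    then have "kdim ?V < kdim V" by (rule kdim_psubset[OF less.prems(1) _ sub(1)])
    moreover have "y \<otimes> z \<in> ?W" if "y \<in> G 1" "z \<in> ?V" for y z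
    proof -
      have "y \<in> carrier R" "z \<in> carrier R" using that Vs(1) G_carrier by blast+
      then have "u \<otimes> (y \<otimes> z) = y \<otimes> (u \<otimes> z)" using u(1) by (simp add: m_lcomm)
      then show ?thesis using that less.prems(4) \<open>y \<in> carrier R\<close> by simp
    qed
    ultimately have IH: "kdim ?V \<le> kdim ?W"
      using less.prems(2) by (intro less.hyps fV fW) auto
    note uV = kdim_mult[OF u(1) less.prems(1)] and uW = kdim_mult[OF u(1) less.prems(3)]
    note xuV = kdim_mult[OF xc uV(1)]
    have "(\<otimes>) x ` (\<otimes>) u ` V \<subseteq> (\<otimes>) u ` W"
    proof
      fix p assume "p \<in> (\<otimes>) x ` (\<otimes>) u ` V"
      then obtain y where y: "y \<in> V" "p = x \<otimes> (u \<otimes> y)" by blast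
      then have "p = u \<otimes> (x \<otimes> y)" using u(1) xc Vs(1) m_lcomm[of x u y] by auto
      then show "p \<in> (\<otimes>) u ` W" using less.prems(4)[OF x(1) y(1)] by blast
    qed
    then have "kdim ((\<otimes>) x ` (\<otimes>) u ` V) \<le> kdim ((\<otimes>) u ` W)"
      by (rule kdim_mono(2)[OF uW(1) _ fin_dim_K_subspace[OF xuV(1)]])
    \<comment> \<open>Multiplication by \<open>x\<close> is injective on \<open>uV\<close>: the
      annihilator of \<open>u\<close> is prime and does not contain \<open>x\<close>.\<close>
    moreover have "{y \<in> (\<otimes>) u ` V. x \<otimes> y = \<zero>} = {\<zero>}"
    proof (intro equalityI subsetI)
      fix p assume "p \<in> {y \<in> (\<otimes>) u ` V. x \<otimes> y = \<zero>}"
      then obtain y where y: "y \<in> V" "p = u \<otimes> y" "x \<otimes> (u \<otimes> y) = \<zero>" by blast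
      have yc: "y \<in> carrier R" using y(1) Vs(1) by blast
      have "u \<otimes> (x \<otimes> y) = \<zero>" using y(3) m_lcomm[of x u y] u(1) xc yc by simp
      then have "p = \<zero>" using prime[OF xc yc _ ux] y(2) by blast
      then show "p \<in> {\<zero>}" by simp
    next
      fix p assume "p \<in> {\<zero>}"
      then show "p \<in> {y \<in> (\<otimes>) u ` V. x \<otimes> y = \<zero>}"
        using K_subspaceD(2)[OF fin_dim_K_subspace[OF uV(1)]] xc by simp
    qed
    \<comment> \<open>Rank-nullity for \<open>u\<close> splits both dimensions: the kernels compare
      by induction, the images because \<open>x\<close> embeds \<open>uV\<close> into
      \<open>uW\<close>.\<close>
    ultimately show ?thesis using uV(2) uW(2) xuV(2) IH by (simp add: kdim_zero)
  qed
qed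

lemma next_annihilated_family:
  assumes red: "reduced_ring R" and t: "t \<ge> 1" and F: "F \<in> annihilated_families R K G t l"
  obtains F' where "F' \<in> annihilated_families R K G (t + 1) l" "Idl F' \<subseteq> Idl F"
proof -
  have FG: "F \<subseteq> G t" and fin: "finite F" and card: "card F = l"
    and indep: "\<not> module.lin_dep (R\<lparr>carrier := K\<rparr>) (self_module R) F"
    and ann: "annihilator R F \<noteq> {\<zero>}"
    using F by (auto simp: annihilated_families_def)
  have Fc: "F \<subseteq> carrier R" using FG G_carrier by blast
  have idF: "ideal (Idl F) R" by (rule genideal_ideal[OF Fc])
  let ?V = "G t \<inter> Idl F" and ?W = "G (t + 1) \<inter> Idl F"
  have "F \<subseteq> ?V" using FG genideal_self[OF Fc] by blast
  then have "l \<le> kdim ?V" using kdim_ge_card[OF G_Int_ideal_fin_dim[OF idF] _ indep] card by simp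
  also have "kdim ?V \<le> kdim ?W"
  proof (rule kdim_le_kdim_shift[OF red t G_Int_ideal_fin_dim[OF idF] _ G_Int_ideal_fin_dim[OF idF]])
    show "?V \<subseteq> G t" by blast
    fix x y assume x: "x \<in> G 1" and y: "y \<in> ?V"
    have "x \<in> carrier R" using x G_carrier by blast
    then show "x \<otimes> y \<in> ?W" using mult_G[OF x, of y t] y idealD(5)[OF idF] by simp
  qed
  finally obtain F' where F': "F' \<subseteq> ?W" "finite F'" "card F' = l"
      "\<not> module.lin_dep (R\<lparr>carrier := K\<rparr>) (self_module R) F'"
    using exists_indep_subset[OF G_Int_ideal_fin_dim[OF idF]] by metis
  have "annihilator R F \<subseteq> annihilator R F'"
  proof
    fix r assume r: "r \<in> annihilator R F"
    then have rc: "r \<in> carrier R" by (simp add: annihilator_def)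
    \<comment> \<open>The elements killed by \<open>r\<close> form an ideal, so \<open>r\<close>
      kills \<open>Idl F\<close> along with \<open>F\<close>.\<close>
    have "F \<subseteq> colon {\<zero>} r" using r Fc by (auto simp: annihilator_def colon_def)
    then have "Idl F \<subseteq> colon {\<zero>} r" by (rule genideal_minimal[OF ideal_colon[OF zeroideal rc]])
    then show "r \<in> annihilator R F'" using F'(1) rc by (auto simp: annihilator_def colon_def)
  qed
  \<comment> \<open>Only with zero in the annihilator does being different from
    \<open>{\<zero>}\<close> provide a nonzero element.\<close>
  moreover have "\<zero> \<in> annihilator R F" using Fc by (auto simp: annihilator_def)
  ultimately have "annihilator R F' \<noteq> {\<zero>}" using ann by blast
  then have "F' \<in> annihilated_families R K G (t + 1) l"
    using F' by (auto simp: annihilated_families_def)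
  moreover have "Idl F' \<subseteq> Idl F" using F'(1) by (intro genideal_minimal[OF idF]) blast
  ultimately show ?thesis by (rule that)
qed

section \<open>Maxima over families, monotonicity and stabilisation\<close>

definition family_multiplicities :: "nat \<Rightarrow> nat \<Rightarrow> real set"
  where "family_multiplicities t l = (\<lambda>F. multiplicity (Idl F)) ` annihilated_families R K G t l"

lemma family_homogeneous: "F \<in> annihilated_families R K G t l \<Longrightarrow> homogeneous_ideal (Idl F)"
  using homogeneous_genideal by (auto simp: annihilated_families_def)

lemma family_multiplicities_bound:
  assumes "m \<in> family_multiplicities t l"
  shows "m \<le> multiplicity {\<zero>}" "\<exists>n. m = real n"
proof -
  obtain F where F: "F \<in> annihilated_families R K G t l" "m = multiplicity (Idl F)"
    using assms by (auto simp: family_multiplicities_def)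
  note h = family_homogeneous[OF F(1)]
  show "\<exists>n. m = real n" using multiplicity_nat[OF h] F(2) by simp
  show "m \<le> multiplicity {\<zero>}"
    using multiplicity_antimono[OF homogeneous_zero h] idealD(2)[OF homogeneous_ideal_ideal[OF h]] F(2) by simp
qed

text \<open>Natural numbers bounded by e(R). Finiteness turns the \<open>GREATEST\<close> of the
  definition into a \<open>Max\<close> that some family attains.\<close>

lemma finite_family_multiplicities: "finite (family_multiplicities t l)"
proof -
  obtain n where n: "multiplicity {\<zero>} = real n" using multiplicity_nat[OF homogeneous_zero] by blast
  have "family_multiplicities t l \<subseteq> real ` {..n}"
    using family_multiplicities_bound n by (metis atMost_iff imageI of_nat_le_iff subsetI)
  then show ?thesis using finite_subset by blast
qed

lemma gen_min_dist_eq: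
  "gen_min_dist R K G t l = (if annihilated_families R K G t l \<noteq> {}
    then multiplicity {\<zero>} - Max (family_multiplicities t l) else multiplicity {\<zero>})"
proof -
  let ?A = "annihilated_families R K G t l"
  have "(\<lambda>F. let I = Idl F in hilbert_samuel_multiplicity R K (quot_module R I) (quot_grading R G I)) ` ?A
      = family_multiplicities t l"
    unfolding family_multiplicities_def Let_def
    by (intro image_cong refl multiplicity_quot homogeneous_ideal_ideal family_homogeneous)
  moreover have "(GREATEST m. m \<in> family_multiplicities t l) = Max (family_multiplicities t l)"
    if "?A \<noteq> {}"
    using that finite_family_multiplicities[of t l]
    by (intro Greatest_equality Max_in Max_ge) (auto simp: family_multiplicities_def)
  ultimately show ?thesis
    unfolding gen_min_dist_def Let_def by (simp add: multiplicity_self)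
qed

lemma gen_min_dist_nat: "\<exists>n. gen_min_dist R K G t l = real n"
proof (cases "annihilated_families R K G t l = {}")
  case True
  then show ?thesis using gen_min_dist_eq multiplicity_nat[OF homogeneous_zero] by simp
next
  case False
  then have "Max (family_multiplicities t l) \<in> family_multiplicities t l"
    by (intro Max_in finite_family_multiplicities) (simp add: family_multiplicities_def)
  then obtain k where k: "Max (family_multiplicities t l) = real k" "real k \<le> multiplicity {\<zero>}"
    using family_multiplicities_bound by metis
  obtain n where n: "multiplicity {\<zero>} = real n" using multiplicity_nat[OF homogeneous_zero] by blast
  have "gen_min_dist R K G t l = real (n - k)"
    using gen_min_dist_eq[of t l] False k n by (simp add: of_nat_diff)
  then show ?thesis ..
qed

lemma gen_min_dist_antimono:
  assumes red: "reduced_ring R" and t: "t \<ge> 1"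
  shows "gen_min_dist R K G (t + 1) l \<le> gen_min_dist R K G t l"
proof (cases "annihilated_families R K G t l = {}")
  case True
  \<comment> \<open>Without families in degree \<open>t\<close> the value there is e(R); the next
    value cannot exceed it because multiplicities are nonnegative.\<close>
  have "Max (family_multiplicities (t + 1) l) \<ge> 0" if "annihilated_families R K G (t + 1) l \<noteq> {}"
  proof -
    have "Max (family_multiplicities (t + 1) l) \<in> family_multiplicities (t + 1) l"
      using that by (intro Max_in finite_family_multiplicities) (simp add: family_multiplicities_def)
    then show ?thesis using family_multiplicities_bound(2) by (metis of_nat_0_le_iff)
  qed
  then show ?thesis using True by (simp add: gen_min_dist_eq)
next
  case False
  then have "Max (family_multiplicities t l) \<in> family_multiplicities t l"
    by (intro Max_in finite_family_multiplicities) (simp add: family_multiplicities_def)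
  then obtain F where F: "F \<in> annihilated_families R K G t l"
      "Max (family_multiplicities t l) = multiplicity (Idl F)"
    by (auto simp: family_multiplicities_def)
  obtain F' where F': "F' \<in> annihilated_families R K G (t + 1) l" "Idl F' \<subseteq> Idl F"
    using next_annihilated_family[OF red t F(1)] .
  have "multiplicity (Idl F) \<le> multiplicity (Idl F')"
    by (rule multiplicity_antimono[OF family_homogeneous[OF F'(1)] family_homogeneous[OF F(1)] F'(2)])
  also have "\<dots> \<le> Max (family_multiplicities (t + 1) l)"
    using F'(1) by (intro Max_ge finite_family_multiplicities) (auto simp: family_multiplicities_def)
  finally show ?thesis using False F' F(2) by (auto simp: gen_min_dist_eq)
qed

end

text \<open>The natural-number values attain their minimum at some \<open>s \<ge> a\<close>; from
  there on they can neither rise nor fall below it.\<close>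

lemma antimono_nat_valued_eventually_const:
  fixes f :: "nat \<Rightarrow> real"
  assumes "\<And>t. t \<ge> a \<Longrightarrow> f (t + 1) \<le> f t" "\<And>t. \<exists>n. f t = real n"
  shows "\<exists>c. \<forall>\<^sub>F t in sequentially. f t = c"
proof -
  obtain g where g: "\<And>t. f t = real (g t)" using assms(2) by metis
  obtain s where s: "s \<ge> a" "\<And>t. t \<ge> a \<Longrightarrow> g s \<le> g t"
    using arg_min_nat_lemma[of "\<lambda>t. t \<ge> a" a g] by (metis order_refl)
  have "g t \<le> g s" if "t \<ge> s" for t
    using that
  proof (induction t rule: dec_induct)
    case (step n)
    then have "g (n + 1) \<le> g n" using assms(1)[of n] s(1) by (simp add: g)
    then show ?case using step.IH by simp
  qed simp
  then have "f t = f s" if "t \<ge> s" for t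
    using s(2)[of t] s(1) that by (simp add: g order_antisym)
  then show ?thesis unfolding eventually_sequentially by blast
qed

theorem theorem1:
  fixes R :: "('a, 'b) ring_scheme" and K :: "'a set" and G :: "nat \<Rightarrow> 'a set"
  assumes "standard_graded_algebra R K G" and "reduced_ring R"
  shows "(\<forall>t\<ge>1. \<forall>l\<ge>1. gen_min_dist R K G t l \<ge> gen_min_dist R K G (t + 1) l) \<and>
    (\<forall>l\<ge>1. \<exists>c. \<forall>\<^sub>F t in sequentially. gen_min_dist R K G t l = c)"
proof -
  interpret standard_graded_algebra R K G by fact
  have "\<exists>c. \<forall>\<^sub>F t in sequentially. gen_min_dist R K G t l = c" for l
    by (rule antimono_nat_valued_eventually_const[where a = 1])
      (use gen_min_dist_antimono[OF assms(2)] gen_min_dist_nat in auto)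
  then show ?thesis using gen_min_dist_antimono[OF assms(2)] by blast
qed

end
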